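(* For any integers $c\ge0$ and $n\ge1$, $$\dim{\mathbf{Hi}_{\underline{c}}}^!(n)=\mathrm{cat}_c(n),$$ where $\mathrm{cat}_c(n):=\frac{1}{cn+1}\binom{cn+n}{n}$ is the $n$-th $c$-Fuss-Catalan number.
   Context: $\mathbb{N}=\{0,1,2,\dots\}$ and $\mathbb{K}$ is a field of characteristic zero. All operads are nonsymmetric operads in $\mathbb{K}$-vector spaces; $\mathcal{O}(n)$ is the arity-$n$ component of $\mathcal{O}$. Fix $c\ge0$. For a word $w$ on $\mathbb{N}$, $\ell(w)$ is its length, $w(i)$ its $i$-th letter, $\epsilon$ the empty word, $|w|:=\ell(w)+1$. $\mathsf{Cl}_{\underline{c}}$ is the set of all words on $\{0,\dots,c\}$, and $\mathsf{Hi}_{\underline{c}}$ is its subset of weakly increasing words. $\mathbf{Cl}_{\underline{c}}$ is the operad with basis $\{\mathsf{E}_w:w\in\mathsf{Cl}_{\underline{c}}\}$, $\mathsf{E}_w$ of arity $|w|$, with $\mathsf{E}_u\circ_i\mathsf{E}_v:=\mathsf{E}_{u(1)\cdots u(i-1)\,v\,u(i)\cdots u(\ell(u))}$ for $1\le i\le|u|$, and unit $\mathsf{E}_\epsilon$. For words of the same length, $u\preccurlyeq v$ iff $u(j)\le v(j)$ for all $j$. The $\mathsf{F}$-basis of $\mathbf{Cl}_{\underline{c}}$ is determined by $\mathsf{E}_w=\sum_{w'\in\mathsf{Cl}_{\underline{c}},\,w\preccurlyeq w'}\mathsf{F}_{w'}$ (Möbius inversion). The span of $\{\mathsf{F}_w:w\in\mathsf{Cl}_{\underline{c}}\setminus\mathsf{Hi}_{\underline{c}}\}$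 is an operad ideal, and $\mathbf{Hi}_{\underline{c}}$ is the quotient operad; for $w\in\mathsf{Hi}_{\underline{c}}$, $\mathsf{E}_w\in\mathbf{Hi}_{\underline{c}}$ denotes the image of $\mathsf{E}_w$. The operad $\mathbf{Hi}_{\underline{c}}$ is binary and quadratic: it is the quotient of the free operad on the arity-$2$ generators $\mathsf{E}_0,\dots,\mathsf{E}_c$ by the ideal generated by the space $R$ (in arity $3$ of the free operad) spanned by $\mathsf{E}_a\circ_1\mathsf{E}_b-\mathsf{E}_b\circ_2\mathsf{E}_{a'}$ for $0\le a,a'\le b\le c$ and $\mathsf{E}_b\circ_1\mathsf{E}_a-\mathsf{E}_a\circ_2\mathsf{E}_b$ for $0\le a<b\le c$. Its Koszul dual ${\mathbf{Hi}_{\underline{c}}}^!$ is the quotient of the free operad on the dual arity-$2$ generators $\mathsf{E}^\star_0,\dots,\mathsf{E}^\star_c$ by the ideal generated by the annihilator $R^\perp$ of $R$ for the pairing in arity $3$ given by $\langle\mathsf{E}^\star_x\circ_i\mathsf{E}^\star_y,\mathsf{E}_{x'}\circ_{i'}\mathsf{E}_{y'}\rangle:=1$ if $(x,y,i)=(x',y',i')$ and $i=1$, $-1$ if $(x,y,i)=(x',y',i')$ and $i=2$, and $0$ otherwise. *)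

theory Defs
  imports
    "HOL-Algebra.AbelCoset"
    "HOL-Library.Tree"
    "HOL-Library.Poly_Mapping"
    "Jordan_Normal_Form.VS_Connect"
begin

section \<open>Quotient vector spaces\<close>

text \<open>Vector spaces over the type \<open>'k\<close> are HOL-Algebra modules over \<open>class_ring\<close>.
  In \<open>smult\<close> the coset \<open>W\<close> is added so that the zero scalar also yields a full coset.
  The fields \<open>mult\<close> and \<open>one\<close> are only there because module records extend ring records.\<close>

definition quotient_space ::
    "('k::field, 'a) module \<Rightarrow> 'a set \<Rightarrow> ('k, 'a set) module" where
  "quotient_space V W =
    \<lparr>carrier = a_rcosets\<^bsub>V\<^esub> W, mult = (\<lambda>_ _. undefined), one = undefined,
     zero = W, add = (\<lambda>A B. A <+>\<^bsub>V\<^esub> B),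
     smult = (\<lambda>k A. W <+>\<^bsub>V\<^esub> ((\<lambda>x. k \<odot>\<^bsub>V\<^esub> x) ` A))\<rparr>"


section \<open>Nonsymmetric operads\<close>

text \<open>\<open>pcomp P n m i x y\<close> is the partial composition of \<open>x\<close>, of arity \<open>n\<close>, with \<open>y\<close>,
  of arity \<open>m\<close>, at the input \<open>i\<close>, where \<open>1 \<le> i \<le> n\<close>.\<close>

record ('k, 'a) ns_operad =
  component :: "nat \<Rightarrow> ('k, 'a) module"
  op_unit :: 'a
  pcomp :: "nat \<Rightarrow> nat \<Rightarrow> nat \<Rightarrow> 'a \<Rightarrow> 'a \<Rightarrow> 'a"

definition operad_dim :: "('k::field, 'a) ns_operad \<Rightarrow> nat \<Rightarrow> nat" where
  "operad_dim P n = vectorspace.dim class_ring (component P n)"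

definition operad_ideal :: "('k::field, 'a) ns_operad \<Rightarrow> (nat \<Rightarrow> 'a set) \<Rightarrow> bool" where
  "operad_ideal P I \<longleftrightarrow>
    (\<forall>n. VectorSpace.subspace class_ring (I n) (component P n)) \<and>
    (\<forall>n m i x y. 1 \<le> i \<longrightarrow> i \<le> n \<longrightarrow> x \<in> I n \<longrightarrow> y \<in> carrier (component P m) \<longrightarrow>
        pcomp P n m i x y \<in> I (n + m - 1)) \<and>
    (\<forall>n m i x y. 1 \<le> i \<longrightarrow> i \<le> n \<longrightarrow> x \<in> carrier (component P n) \<longrightarrow> y \<in> I m \<longrightarrow>
        pcomp P n m i x y \<in> I (n + m - 1))"

text \<open>The ideal generated by a set \<open>S\<close> of elements of arity \<open>k\<close>.\<close>

definition generated_ideal ::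
    "('k::field, 'a) ns_operad \<Rightarrow> nat \<Rightarrow> 'a set \<Rightarrow> nat \<Rightarrow> 'a set" where
  "generated_ideal P k S n = \<Inter> {I n | I. operad_ideal P I \<and> S \<subseteq> I k}"

definition quotient_operad ::
    "('k::field, 'a) ns_operad \<Rightarrow> (nat \<Rightarrow> 'a set) \<Rightarrow> ('k, 'a set) ns_operad" where
  "quotient_operad P I =
    \<lparr>component = (\<lambda>n. quotient_space (component P n) (I n)),
     op_unit = I 1 +>\<^bsub>component P 1\<^esub> op_unit P,
     pcomp = (\<lambda>n m i A B.
       \<Union>x\<in>A. \<Union>y\<in>B. I (n + m - 1) +>\<^bsub>component P (n + m - 1)\<^esub> pcomp P n m i x y)\<rparr>"


section \<open>Free operads on binary generators\<close>

text \<open>The free operad on a set \<open>X\<close> of generators of arity 2 has as basis in arity \<open>n\<close> the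
  planar binary trees with \<open>n\<close> leaves (counted by \<open>size1\<close>) and inner nodes labelled by \<open>X\<close>.\<close>

fun graft :: "nat \<Rightarrow> 'g tree \<Rightarrow> 'g tree \<Rightarrow> 'g tree" where
  "graft i \<langle>\<rangle> s = s"
| "graft i \<langle>l, a, r\<rangle> s =
    (if i \<le> size1 l then \<langle>graft i l s, a, r\<rangle> else \<langle>l, a, graft (i - size1 l) r s\<rangle>)"

definition free_component :: "'g set \<Rightarrow> nat \<Rightarrow> ('k::field, 'g tree \<Rightarrow>\<^sub>0 'k) module" where
  "free_component X n =
    \<lparr>carrier = {f. Poly_Mapping.keys f \<subseteq> {t. size1 t = n \<and> set_tree t \<subseteq> X}},
     mult = (\<lambda>_ _. undefined), one = undefined,
     zero = 0, add = (+), smult = (\<lambda>k. Poly_Mapping.map ((*) k))\<rparr>"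

definition free_pcomp ::
    "nat \<Rightarrow> ('g tree \<Rightarrow>\<^sub>0 'k::field) \<Rightarrow> ('g tree \<Rightarrow>\<^sub>0 'k) \<Rightarrow> ('g tree \<Rightarrow>\<^sub>0 'k)" where
  "free_pcomp i f g =
    (\<Sum>s\<in>Poly_Mapping.keys f. \<Sum>t\<in>Poly_Mapping.keys g.
       Poly_Mapping.single (graft i s t) (Poly_Mapping.lookup f s * Poly_Mapping.lookup g t))"

definition free_operad :: "'g set \<Rightarrow> ('k::field, 'g tree \<Rightarrow>\<^sub>0 'k) ns_operad" where
  "free_operad X =
    \<lparr>component = free_component X, op_unit = Poly_Mapping.single \<langle>\<rangle> 1,
     pcomp = (\<lambda>n m. free_pcomp)\<rparr>"

definition corolla :: "'g \<Rightarrow> 'g tree" where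
  "corolla a = \<langle>\<langle>\<rangle>, a, \<langle>\<rangle>\<rangle>"

definition gen :: "'g \<Rightarrow> ('g tree \<Rightarrow>\<^sub>0 'k::field)" where
  "gen a = Poly_Mapping.single (corolla a) 1"


section \<open>Binary quadratic operads and Koszul duality\<close>

definition quadratic_operad ::
    "'g set \<Rightarrow> ('g tree \<Rightarrow>\<^sub>0 'k::field) set \<Rightarrow> ('k, ('g tree \<Rightarrow>\<^sub>0 'k) set) ns_operad" where
  "quadratic_operad X R = quotient_operad (free_operad X) (generated_ideal (free_operad X) 3 R)"

text \<open>The dual generator of \<open>x\<close> is labelled by \<open>x\<close> again, so both arguments of the pairing
  live in the arity 3 component of \<open>free_operad X\<close>. The trees \<open>graft 1 (corolla x) (corolla y)\<close>
  and \<open>graft 2 (corolla x) (corolla y)\<close> are all the trees with three leaves.\<close>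

definition tree_pairing :: "'g tree \<Rightarrow> 'g tree \<Rightarrow> 'k::field" where
  "tree_pairing s t =
    (if s \<noteq> t then 0
     else if \<exists>x y. s = graft 1 (corolla x) (corolla y) then 1
     else if \<exists>x y. s = graft 2 (corolla x) (corolla y) then - 1
     else 0)"

definition pairing :: "('g tree \<Rightarrow>\<^sub>0 'k::field) \<Rightarrow> ('g tree \<Rightarrow>\<^sub>0 'k) \<Rightarrow> 'k" where
  "pairing f g =
    (\<Sum>s\<in>Poly_Mapping.keys f. \<Sum>t\<in>Poly_Mapping.keys g.
       Poly_Mapping.lookup f s * Poly_Mapping.lookup g t * tree_pairing s t)"

definition annihilator ::
    "'g set \<Rightarrow> ('g tree \<Rightarrow>\<^sub>0 'k::field) set \<Rightarrow> ('g tree \<Rightarrow>\<^sub>0 'k) set" where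
  "annihilator X R = {f \<in> carrier (component (free_operad X) 3). \<forall>g\<in>R. pairing f g = 0}"

text \<open>The Koszul dual of \<open>quadratic_operad X R\<close>, for a space \<open>R\<close> of relations of arity 3.\<close>

definition koszul_dual ::
    "'g set \<Rightarrow> ('g tree \<Rightarrow>\<^sub>0 'k::field) set \<Rightarrow> ('k, ('g tree \<Rightarrow>\<^sub>0 'k) set) ns_operad" where
  "koszul_dual X R = quadratic_operad X (annihilator X R)"


section \<open>The operad Hi and Fuss-Catalan numbers\<close>

text \<open>\<open>Hi\<close> with parameter \<open>c\<close> is \<open>quadratic_operad {0..c} (Hi_relations c)\<close>, its binary
  quadratic presentation.\<close>

definition Hi_relations :: "nat \<Rightarrow> (nat tree \<Rightarrow>\<^sub>0 'k::field) set" where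
  "Hi_relations c =
    LinearCombinations.module.span class_ring (component (free_operad {0..c}) 3)
      ({free_pcomp 1 (gen a) (gen b) - free_pcomp 2 (gen b) (gen a') | a a' b.
          a \<le> b \<and> a' \<le> b \<and> b \<le> c} \<union>
       {free_pcomp 1 (gen b) (gen a) - free_pcomp 2 (gen a) (gen b) | a b.
          a < b \<and> b \<le> c})"

definition fuss_catalan :: "nat \<Rightarrow> nat \<Rightarrow> rat" where
  "fuss_catalan c n = 1 / of_nat (c * n + 1) * of_nat ((c * n + n) choose n)"

end

theory Submission
  imports Defs "HOL-Computational_Algebra.Formal_Power_Series"
begin

text \<open>Let \<open>E a\<close> be the dual generators and \<open>S b\<close> the sum of the \<open>E a\<close> with \<open>a \<le> b\<close>. In the
  basis \<open>S\<close>, the annihilator of the relations is spanned by the differences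
  \<open>(u S\<^sub>a v) S\<^sub>b w - u S\<^sub>a (v S\<^sub>b w)\<close> for \<open>a \<le> b\<close>. Oriented from left to right these
  relations are confluent, and the normal forms are the trees in which each left child has a label
  larger than its parent. Such a tree is a strictly decreasing path of labels down its
  left branch (read from the bottom), with a normal right subtree at each node of the path, so the
  generating function \<open>F\<close> satisfies \<open>F = z (1 + F)\<^bsup>c+1\<^esup>\<close>, the equation of the Fuss-Catalan numbers.

  Confluence takes the form of an algebra structure on the span of all trees
  (\<open>normal_mult_assoc\<close>). Evaluating trees in this algebra has the ideal of relations in its
  kernel, while rewriting shows that modulo any ideal containing the annihilator
  an element is determined by its evaluation; hence the ideal is the kernel.\<close>

section \<open>Normal trees\<close>

text \<open>With labels read as the sums \<open>S\<close>, this is the normal form of a node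
  \<open>b\<close> over normal trees \<open>s\<close> and \<open>t\<close>: the rewrite rule is
  applied at the root and continues into the right subtree, the only place where it can become
  applicable again.\<close>

fun normal_mult :: "'g::linorder \<Rightarrow> 'g tree \<Rightarrow> 'g tree \<Rightarrow> 'g tree" where
  "normal_mult b \<langle>\<rangle> t = \<langle>\<langle>\<rangle>, b, t\<rangle>"
| "normal_mult b \<langle>l, a, r\<rangle> t =
    (if a \<le> b then \<langle>l, a, normal_mult b r t\<rangle> else \<langle>\<langle>l, a, r\<rangle>, b, t\<rangle>)"

text \<open>Induction on \<open>s\<close>: a root label at most \<open>a\<close> is also at most
  \<open>b\<close>, and both sides descend into the right subtree; otherwise both stop at the same
  node. Being valid for all trees, the law allows arbitrary elements as inputs of the evaluation
  below.\<close>

lemma normal_mult_assoc: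
  "a \<le> b \<Longrightarrow> normal_mult b (normal_mult a s t) u = normal_mult a s (normal_mult b t u)"
  by (induction s) auto

lemma size1_normal_mult [simp]: "size1 (normal_mult b s t) = size1 s + size1 t"
  by (induction s) auto

text \<open>The parameter \<open>k\<close> bounds the root label from below. Passing
  \<open>Suc a\<close> to the left makes labels grow strictly down a left branch, while a right
  subtree starts afresh at 0.\<close>

fun normal_tree :: "nat \<Rightarrow> nat \<Rightarrow> nat tree \<Rightarrow> bool" where
  "normal_tree c k \<langle>\<rangle> \<longleftrightarrow> True"
| "normal_tree c k \<langle>l, a, r\<rangle> \<longleftrightarrow> k \<le> a \<and> a \<le> c \<and> normal_tree c (Suc a) l \<and> normal_tree c 0 r"

lemma normal_tree_set_tree: "normal_tree c k t \<Longrightarrow> set_tree t \<subseteq> {0..c}"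
  by (induction c k t rule: normal_tree.induct) auto

lemma normal_tree_normal_mult:
  "normal_tree c k s \<Longrightarrow> normal_tree c 0 t \<Longrightarrow> k \<le> a \<Longrightarrow> a \<le> c \<Longrightarrow> normal_tree c k (normal_mult a s t)"
  by (induction s arbitrary: k) auto

text \<open>No rewriting takes place: the left child is a leaf or has a label larger than
  \<open>a\<close>.\<close>

lemma normal_mult_eq_Node: "normal_tree c (Suc a) l \<Longrightarrow> normal_mult a l r = \<langle>l, a, r\<rangle>"
  by (cases l) auto

section \<open>Finiteness of the sets of trees\<close>

lemma finite_trees:
  assumes "finite X"
  shows "finite {t. size1 t = n \<and> set_tree t \<subseteq> X}"
proof -
  \<comment> \<open>Trees of bounded height are built from trees of smaller height, and the number
    of leaves bounds the height.\<close>
  have "finite {t. height t \<le> m \<and> set_tree t \<subseteq> X}" for m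
  proof (induction m)
    case (Suc m)
    let ?S = "{t. height t \<le> m \<and> set_tree t \<subseteq> X}"
    have "{t. height t \<le> Suc m \<and> set_tree t \<subseteq> X}
        \<subseteq> insert \<langle>\<rangle> ((\<lambda>(l, a, r). \<langle>l, a, r\<rangle>) ` (?S \<times> X \<times> ?S))"
    proof
      fix t assume t: "t \<in> {t. height t \<le> Suc m \<and> set_tree t \<subseteq> X}"
      show "t \<in> insert \<langle>\<rangle> ((\<lambda>(l, a, r). \<langle>l, a, r\<rangle>) ` (?S \<times> X \<times> ?S))"
      proof (cases t)
        case (Node l a r)
        with t have "(l, a, r) \<in> ?S \<times> X \<times> ?S" by auto
        with Node show ?thesis by (force intro: rev_image_eqI)
      qed simp
    qed
    then show ?case
      by (rule finite_subset) (use Suc assms in auto)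
  qed (simp add: conj_commute cong: conj_cong)
  from this[of n] show ?thesis
    by (rule rev_finite_subset) (auto simp: size1_size intro: order.trans[OF height_le_size_tree])
qed

definition normal_trees :: "nat \<Rightarrow> nat \<Rightarrow> nat \<Rightarrow> nat tree set" where
  "normal_trees c k n = {t. size1 t = n \<and> normal_tree c k t}"

lemma finite_normal_trees: "finite (normal_trees c k n)"
  unfolding normal_trees_def
  by (rule finite_subset[OF _ finite_trees[of "{0..c}" n]]) (use normal_tree_set_tree in blast, simp)

section \<open>Counting normal trees\<close>

text \<open>No label lies above \<open>c\<close>, so only the leaf survives. This starts the
  downward recursion on the lower bound.\<close>

lemma card_normal_trees_Suc: "card (normal_trees c (Suc c) n) = (if n = 1 then 1 else 0)"
proof -
  have "normal_tree c (Suc c) t \<longleftrightarrow> t = \<langle>\<rangle>" for t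
    by (cases t) auto
  then have "normal_trees c (Suc c) n = {t. size1 t = n \<and> t = \<langle>\<rangle>}"
    by (simp only: normal_trees_def)
  also have "\<dots> = (if n = 1 then {\<langle>\<rangle>} else {})"
    by auto
  finally show ?thesis by simp
qed

text \<open>A tree with lower bound \<open>k\<close> either satisfies the bound \<open>Suc k\<close>
  or has root label \<open>k\<close>. In the second case it is a pair of a left subtree with bound
  \<open>Suc k\<close> and \<open>i\<close> leaves and a right subtree with bound 0.\<close>

lemma card_normal_trees_rec:
  assumes "k \<le> c"
  shows "card (normal_trees c k n) = card (normal_trees c (Suc k) n)
    + (\<Sum>i=0..n. card (normal_trees c (Suc k) i) * card (normal_trees c 0 (n - i)))"
proof -
  define P where "P i = normal_trees c (Suc k) i \<times> normal_trees c 0 (n - i)" for i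
  let ?f = "\<lambda>(l, r). \<langle>l, k, r\<rangle> :: nat tree"
  have fin: "finite (P i)" for i
    unfolding P_def by (intro finite_cartesian_product finite_normal_trees)
  define U where "U = (\<Union>i\<in>{0..n}. P i)"
  have in_U: "(l, r) \<in> U \<longleftrightarrow> size1 l + size1 r = n \<and> normal_tree c (Suc k) l \<and> normal_tree c 0 r" for l r
  proof -
    have "(l, r) \<in> U \<longleftrightarrow> size1 l \<le> n \<and> size1 r = n - size1 l \<and> normal_tree c (Suc k) l \<and> normal_tree c 0 r"
      by (auto simp: U_def P_def normal_trees_def)
    moreover have "size1 l \<le> n \<and> size1 r = n - size1 l \<longleftrightarrow> size1 l + size1 r = n"
      using size1_ge0[of r] by linarith
    ultimately show ?thesis by blast
  qed
  have in_fU: "t \<in> ?f ` U \<longleftrightarrow> (\<exists>l r. t = \<langle>l, k, r\<rangle> \<and> (l, r) \<in> U)" for t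
    unfolding image_iff Bex_def split_paired_Ex by (simp only: prod.case conj_commute)
  have "t \<in> normal_trees c k n \<longleftrightarrow> t \<in> normal_trees c (Suc k) n \<or> t \<in> ?f ` U" for t
    using assms unfolding in_fU in_U
    by (cases t) (auto simp: normal_trees_def not_less_eq_eq dest: le_antisym)
  then have eq: "normal_trees c k n = normal_trees c (Suc k) n \<union> ?f ` U"
    by blast
  have disj: "normal_trees c (Suc k) n \<inter> ?f ` U = {}"
    unfolding disjoint_iff in_fU by (auto simp: normal_trees_def)
  have "card (?f ` U) = card U"
    by (rule card_image) (auto simp: inj_on_def)
  also have "\<dots> = (\<Sum>i=0..n. card (P i))"
    unfolding U_def
  proof (rule card_UN_disjoint)
    show "\<forall>i\<in>{0..n}. \<forall>j\<in>{0..n}. i \<noteq> j \<longrightarrow> P i \<inter> P j = {}"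
      unfolding P_def by (auto simp: normal_trees_def)
  qed (use fin in auto)
  finally have "card (?f ` U)
      = (\<Sum>i=0..n. card (normal_trees c (Suc k) i) * card (normal_trees c 0 (n - i)))"
    by (simp add: P_def card_cartesian_product)
  then show ?thesis
    unfolding eq by (subst card_Un_disjoint) (use fin finite_normal_trees disj in \<open>auto simp: U_def\<close>)
qed

text \<open>\<open>B\<close> is the generalised binomial series, and this is Raney's formula for its
  powers. The induction is on \<open>n\<close> and, inside, on \<open>r\<close>, through
  \<open>B^(r+1) = B^r + X B^(r+p)\<close>. At (0, 0) the formula divides by zero and would give 0
  instead of 1.\<close>

lemma fps_raney_nth:
  fixes B :: "'a::field_char_0 fps"
  assumes B: "B = 1 + fps_X * B ^ p" and "p > 0" "(n, r) \<noteq> (0, 0)"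
  shows "fps_nth (B ^ r) n = of_nat r / of_nat (p * n + r) * of_nat ((p * n + r) choose n)"
  using \<open>(n, r) \<noteq> (0, 0)\<close>
proof (induction n arbitrary: r)
  case 0
  have "fps_nth B 0 = 1"
    by (subst B) simp
  then have "fps_nth (B ^ r) 0 = 1"
    by (simp add: fps_nth_power_0)
  with 0 show ?case by simp
next
  case (Suc m)
  show ?case
  proof (induction r)
    case (Suc r)
    \<comment> \<open>The outer hypothesis is used at \<open>(m, r + p)\<close>, and
      \<open>p * m + (r + p)\<close> is again \<open>p * Suc m + r\<close>; so both summands have
      the same upper index \<open>M\<close>.\<close>
    define M where "M = p * Suc m + r"
    have M: "of_nat M = (of_nat p * (of_nat m + 1) + of_nat r :: 'a)"
      by (simp add: M_def algebra_simps)
    have "M > 0" using \<open>p > 0\<close> by (simp add: M_def)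
    have "Suc m \<le> M"
      using mult_le_mono1[of 1 p "Suc m"] \<open>p > 0\<close> by (simp add: M_def)
    have y: "of_nat (Suc m) * of_nat (M choose Suc m) = (of_nat M - of_nat m) * (of_nat (M choose m) :: 'a)"
    proof -
      have "Suc m * (M choose Suc m) = (M - m) * (M choose m)"
        by (metis binomial_absorb_comp binomial_absorption)
      from arg_cong[OF this, of "of_nat :: nat \<Rightarrow> 'a"] show ?thesis
        using \<open>Suc m \<le> M\<close> by (simp only: of_nat_mult of_nat_diff Suc_leD)
    qed
    have "B ^ Suc r = B ^ r + fps_X * B ^ (r + p)"
      by (subst power_Suc2, subst (2) B) (simp add: algebra_simps power_add)
    then have "fps_nth (B ^ Suc r) (Suc m) = fps_nth (B ^ r) (Suc m) + fps_nth (B ^ (r + p)) m"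
      by simp
    also have "fps_nth (B ^ (r + p)) m = of_nat (r + p) / of_nat M * of_nat (M choose m)"
      using Suc.prems \<open>p > 0\<close> by (subst \<open>\<And>r. (m, r) \<noteq> (0, 0) \<Longrightarrow> _\<close>) (auto simp: M_def algebra_simps)
    also have "fps_nth (B ^ r) (Suc m) = of_nat r / of_nat M * of_nat (M choose Suc m)"
      using Suc by (simp add: M_def)
    finally have *: "fps_nth (B ^ Suc r) (Suc m) = of_nat r / of_nat M * of_nat (M choose Suc m)
      + of_nat (r + p) / of_nat M * of_nat (M choose m)" .
    have N: "p * Suc m + Suc r = Suc M" by (simp add: M_def)
    have nz: "of_nat M \<noteq> (0 :: 'a)" "of_nat (Suc M) \<noteq> (0 :: 'a)" "of_nat (Suc m) \<noteq> (0::'a)"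
      using \<open>M > 0\<close> by (auto simp del: of_nat_Suc)
    \<comment> \<open>By absorption \<open>y\<close> is a rational multiple of \<open>x\<close>,
      which leaves an identity between rational factors of \<open>x\<close>.\<close>
    define x y where "x = (of_nat (M choose m) :: 'a)" and "y = (of_nat (M choose Suc m) :: 'a)"
    have y_eq: "y = (of_nat M - of_nat m) * x / of_nat (Suc m)"
      using y nz(3) unfolding x_def y_def by (metis nonzero_mult_div_cancel_left)
    have "of_nat (Suc r) / of_nat (Suc M) * of_nat (Suc M choose Suc m)
        = of_nat (Suc r) / of_nat (Suc M) * (x + y)"
      by (simp add: x_def y_def)
    also have "x + y = x * of_nat (Suc M) / of_nat (Suc m)"
      using nz(3) unfolding y_eq by (simp add: divide_simps) (simp add: algebra_simps)
    also have "of_nat (Suc r) / of_nat (Suc M) * (x * of_nat (Suc M) / of_nat (Suc m))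
        = of_nat (Suc r) * x / of_nat (Suc m)"
      using nz by simp
    also have "\<dots> = of_nat r / of_nat M * y + of_nat (r + p) / of_nat M * x"
    proof -
      have "of_nat M * (of_nat (Suc r) * x)
          = of_nat r * ((of_nat M - of_nat m) * x) + of_nat (Suc m) * (of_nat (r + p) * x)"
        by (simp add: M algebra_simps)
      then show ?thesis
        using nz(1,3) unfolding y_eq by (simp add: divide_simps mult_ac del: of_nat_Suc of_nat_add)
    qed
    finally show ?case
      unfolding N * by (simp only: x_def y_def)
  qed simp
qed

text \<open>\<open>G k\<close> is the generating function for lower bound \<open>k\<close>. The
  recursion reads \<open>G k = G (Suc k) * B\<close>; iterated from \<open>G (Suc c) = X\<close> it
  gives \<open>G 0 = X B^(c+1)\<close>, the equation of Raney's formula with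
  \<open>p = Suc c\<close>.\<close>

lemma card_normal_trees:
  assumes "n \<ge> 1"
  shows "of_nat (card (normal_trees c 0 n)) = fuss_catalan c n"
proof -
  define G :: "nat \<Rightarrow> rat fps" where "G k = Abs_fps (\<lambda>n. of_nat (card (normal_trees c k n)))" for k
  define B where "B = 1 + G 0"
  have "G k = G (Suc k) + G (Suc k) * G 0" if "k \<le> c" for k
    by (rule fps_ext) (simp add: G_def fps_mult_nth card_normal_trees_rec[OF that])
  then have G_rec: "G k = G (Suc k) * B" if "k \<le> c" for k
    using that by (metis B_def mult.right_neutral distrib_left)
  have "G (Suc c - r) = fps_X * B ^ r" if "r \<le> Suc c" for r
    using that
  proof (induction r)
    case 0
    show ?case by (rule fps_ext) (simp add: G_def card_normal_trees_Suc)
  next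
    case (Suc r)
    then have "G (Suc c - Suc r) = G (Suc c - r) * B"
      using G_rec[of "Suc c - Suc r"] by (simp add: Suc_diff_le)
    with Suc show ?case by (simp add: mult_ac)
  qed
  from this[of "Suc c"] have "B = 1 + fps_X * B ^ Suc c"
    by (simp add: B_def)
  \<comment> \<open>The power \<open>r = 1\<close> yields the upper index
    \<open>c * n + n + 1\<close>; absorption then lowers it to \<open>c * n + n\<close> and changes
    the denominator to \<open>c * n + 1\<close>.\<close>
  from fps_raney_nth[OF this, of n 1] assms
  have "fps_nth B n = 1 / of_nat (Suc (c * n + n)) * of_nat (Suc (c * n + n) choose n)"
    by (simp add: algebra_simps)
  also have "\<dots> = fuss_catalan c n"
  proof -
    have "(Suc (c * n + n) - n) * (Suc (c * n + n) choose n) = Suc (c * n + n) * ((c * n + n) choose n)"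
      using binomial_absorb_comp[of "Suc (c * n + n)" n] by (simp only: diff_Suc_1)
    then have "Suc (c * n) * (Suc (c * n + n) choose n) = Suc (c * n + n) * ((c * n + n) choose n)"
      by simp
    from arg_cong[OF this, of "of_nat :: nat \<Rightarrow> rat"] show ?thesis
      unfolding fuss_catalan_def of_nat_mult
      by (simp add: field_simps del: of_nat_mult binomial_Suc_Suc)
  qed
  finally show ?thesis using assms by (simp add: B_def G_def)
qed

section \<open>Linear and bilinear extensions\<close>

abbreviation scale :: "'k::field \<Rightarrow> ('a \<Rightarrow>\<^sub>0 'k) \<Rightarrow> ('a \<Rightarrow>\<^sub>0 'k)" where
  "scale k \<equiv> Poly_Mapping.map ((*) k)"

lemma lookup_scale [simp]: "Poly_Mapping.lookup (scale k f) x = k * Poly_Mapping.lookup f x"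
  by (simp add: Poly_Mapping.map.rep_eq when_def)

lemma scale_single [simp]: "scale k (Poly_Mapping.single x l) = Poly_Mapping.single x (k * l)"
  by (rule poly_mapping_eqI) (simp add: lookup_single when_def)

lemma keys_scale: "Poly_Mapping.keys (scale k f) \<subseteq> Poly_Mapping.keys f"
  by (auto simp: in_keys_iff)

text \<open>This type-based vector space supplies the calculus of linear maps; the carrier-based
  modules of the statement are connected to it later by \<open>supp_space\<close>.\<close>

interpretation pm: vector_space "scale :: 'k::field \<Rightarrow> ('a \<Rightarrow>\<^sub>0 'k) \<Rightarrow> _"
  by unfold_locales (auto intro!: poly_mapping_eqI simp: lookup_add algebra_simps)

interpretation pm: vector_space_pair
  "scale :: 'k::field \<Rightarrow> ('a \<Rightarrow>\<^sub>0 'k) \<Rightarrow> _" "scale :: 'k \<Rightarrow> ('b \<Rightarrow>\<^sub>0 'k) \<Rightarrow> _"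
  by unfold_locales

abbreviation linear :: "(('a \<Rightarrow>\<^sub>0 'k::field) \<Rightarrow> ('b \<Rightarrow>\<^sub>0 'k)) \<Rightarrow> bool" where
  "linear \<equiv> Vector_Spaces.linear scale scale"

lemma linearI:
  assumes "\<And>f g. L (f + g) = L f + L g" "\<And>k f. L (scale k f) = scale k (L f)"
  shows "linear L"
  using assms by (simp add: Vector_Spaces.linear_iff pm.vector_space_axioms)

definition lin_ext :: "('a \<Rightarrow> ('b \<Rightarrow>\<^sub>0 'k::field)) \<Rightarrow> ('a \<Rightarrow>\<^sub>0 'k) \<Rightarrow> ('b \<Rightarrow>\<^sub>0 'k)" where
  "lin_ext \<phi> f = (\<Sum>x\<in>Poly_Mapping.keys f. scale (Poly_Mapping.lookup f x) (\<phi> x))"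

text \<open>Padding with zero coefficients puts the sums for several elements over one index
  set.\<close>

lemma lin_ext_superset:
  assumes "finite K" "Poly_Mapping.keys f \<subseteq> K"
  shows "lin_ext \<phi> f = (\<Sum>x\<in>K. scale (Poly_Mapping.lookup f x) (\<phi> x))"
  unfolding lin_ext_def
  by (rule sum.mono_neutral_left[OF assms]) (auto simp: in_keys_iff)

lemma lin_ext_cong: "(\<And>x. x \<in> Poly_Mapping.keys f \<Longrightarrow> \<phi> x = \<psi> x) \<Longrightarrow> lin_ext \<phi> f = lin_ext \<psi> f"
  by (simp add: lin_ext_def)

lemma lin_ext_single [simp]: "lin_ext \<phi> (Poly_Mapping.single x k) = scale k (\<phi> x)"
  by (subst lin_ext_superset[where K = "{x}"]) auto

lemma linear_lin_ext:
  fixes \<phi> :: "'a \<Rightarrow> ('b \<Rightarrow>\<^sub>0 'k::field)"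
  shows "linear (lin_ext \<phi>)"
proof (rule linearI)
  fix f g :: "'a \<Rightarrow>\<^sub>0 'k" and k
  let ?K = "Poly_Mapping.keys f \<union> Poly_Mapping.keys g"
  have "Poly_Mapping.keys (f + g) \<subseteq> ?K"
    by (rule Poly_Mapping.keys_add)
  then show "lin_ext \<phi> (f + g) = lin_ext \<phi> f + lin_ext \<phi> g"
    by (simp add: lin_ext_superset[of ?K] lookup_add pm.scale_left_distrib sum.distrib)
  show "lin_ext \<phi> (scale k f) = scale k (lin_ext \<phi> f)"
    using keys_scale[of k f]
    by (simp add: lin_ext_superset[of "Poly_Mapping.keys f"] pm.scale_sum_right)
qed

lemmas lin_ext_0 [simp] = pm.linear_0[OF linear_lin_ext]
lemmas lin_ext_add = pm.linear_add[OF linear_lin_ext]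
lemmas lin_ext_diff = pm.linear_diff[OF linear_lin_ext]
lemmas lin_ext_scale = pm.linear_scale[OF linear_lin_ext]

lemma linear_lin_ext_commute:
  assumes "linear L"
  shows "L (lin_ext \<phi> f) = lin_ext (\<lambda>x. L (\<phi> x)) f"
  by (simp add: lin_ext_def pm.linear_sum[OF assms] pm.linear_scale[OF assms])

lemma lin_ext_singles: "lin_ext (\<lambda>x. Poly_Mapping.single x 1) f = f"
  by (rule poly_mapping_eqI)
     (auto simp: lin_ext_def lookup_sum lookup_single when_def not_in_keys_iff_lookup_eq_zero
        if_distrib[of "\<lambda>x. _ * x"] sum.delta cong: if_cong)

lemma linear_eqI:
  assumes "linear L" "linear M"
    and "\<And>x. x \<in> Poly_Mapping.keys f \<Longrightarrow> L (Poly_Mapping.single x 1) = M (Poly_Mapping.single x 1)"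
  shows "L f = M f"
proof -
  have "L (lin_ext (\<lambda>x. Poly_Mapping.single x 1) f) = M (lin_ext (\<lambda>x. Poly_Mapping.single x 1) f)"
    unfolding linear_lin_ext_commute[OF assms(1)] linear_lin_ext_commute[OF assms(2)]
    using assms(3) by (rule lin_ext_cong)
  then show ?thesis by (simp only: lin_ext_singles)
qed

lemma keys_sum_subset: "Poly_Mapping.keys (sum g A) \<subseteq> (\<Union>x\<in>A. Poly_Mapping.keys (g x))"
proof (induction A rule: infinite_finite_induct)
  case (insert x A)
  then show ?case using Poly_Mapping.keys_add[of "g x" "sum g A"] by auto
qed auto

lemma keys_lin_ext: "Poly_Mapping.keys (lin_ext \<phi> f) \<subseteq> (\<Union>x\<in>Poly_Mapping.keys f. Poly_Mapping.keys (\<phi> x))"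
  unfolding lin_ext_def using keys_sum_subset keys_scale by fastforce

lemma linear_lin_ext_fun:
  assumes "\<And>x. x \<in> Poly_Mapping.keys f \<Longrightarrow> linear (\<lambda>g. \<phi> g x)"
  shows "linear (\<lambda>g. lin_ext (\<phi> g) f)"
proof (rule linearI)
  fix g h k
  show "lin_ext (\<phi> (g + h)) f = lin_ext (\<phi> g) f + lin_ext (\<phi> h) f"
    by (simp add: lin_ext_def pm.linear_add[OF assms] pm.scale_right_distrib sum.distrib)
  show "lin_ext (\<phi> (scale k g)) f = scale k (lin_ext (\<phi> g) f)"
    by (simp add: lin_ext_def pm.linear_scale[OF assms] pm.scale_sum_right mult.commute)
qed

lemma linear_compose:
  "linear (L :: ('a \<Rightarrow>\<^sub>0 'k::field) \<Rightarrow> ('b \<Rightarrow>\<^sub>0 'k)) \<Longrightarrow> linear (M :: ('b \<Rightarrow>\<^sub>0 'k) \<Rightarrow> ('c \<Rightarrow>\<^sub>0 'k))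
    \<Longrightarrow> linear (\<lambda>x. M (L x))"
  using Vector_Spaces.linear_compose[of scale scale L scale M] by (simp add: o_def)

lemma lin_ext_swap:
  "lin_ext (\<lambda>x. lin_ext (\<lambda>y. \<phi> x y) g) f = lin_ext (\<lambda>y. lin_ext (\<lambda>x. \<phi> x y) f) g"
  unfolding lin_ext_def pm.scale_sum_right
  by (subst sum.swap) (simp add: mult.commute)

section \<open>Bilinear extensions of operations on basis elements\<close>

definition bil :: "('a \<Rightarrow> 'b \<Rightarrow> 'c) \<Rightarrow> ('a \<Rightarrow>\<^sub>0 'k::field) \<Rightarrow> ('b \<Rightarrow>\<^sub>0 'k) \<Rightarrow> ('c \<Rightarrow>\<^sub>0 'k)" where
  "bil h f g = lin_ext (\<lambda>s. lin_ext (\<lambda>t. Poly_Mapping.single (h s t) 1) g) f"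

lemma linear_bil_left: "linear (\<lambda>f. bil h f g)"
  unfolding bil_def by (rule linear_lin_ext)

lemma linear_bil_right: "linear (\<lambda>g. bil h f g)"
  unfolding bil_def by (intro linear_lin_ext_fun linear_lin_ext)

lemma bil_single [simp]:
  "bil h (Poly_Mapping.single s k) (Poly_Mapping.single t l) = Poly_Mapping.single (h s t) (k * l)"
  by (simp add: bil_def)

lemma lin_ext_bil: "lin_ext \<phi> (bil h f g) = lin_ext (\<lambda>s. lin_ext (\<lambda>t. \<phi> (h s t)) g) f"
  unfolding bil_def by (simp add: linear_lin_ext_commute[OF linear_lin_ext])

lemma keys_bil:
  fixes f :: "'a \<Rightarrow>\<^sub>0 'k::field"
  shows
  "Poly_Mapping.keys (bil h f g) \<subseteq> (\<lambda>(s, t). h s t) ` (Poly_Mapping.keys f \<times> Poly_Mapping.keys g)"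
proof
  fix u assume "u \<in> Poly_Mapping.keys (bil h f g)"
  from subsetD[OF keys_lin_ext this[unfolded bil_def]]
  obtain s where s: "s \<in> Poly_Mapping.keys f"
      "u \<in> Poly_Mapping.keys (lin_ext (\<lambda>t. Poly_Mapping.single (h s t) (1 :: 'k)) g)"
    by (rule UN_E)
  from subsetD[OF keys_lin_ext s(2)]
  obtain t where "t \<in> Poly_Mapping.keys g" "u \<in> Poly_Mapping.keys (Poly_Mapping.single (h s t) (1 :: 'k))"
    by (rule UN_E)
  with s(1) show "u \<in> (\<lambda>(s, t). h s t) ` (Poly_Mapping.keys f \<times> Poly_Mapping.keys g)"
    by (intro image_eqI[of _ _ "(s, t)"]) auto
qed

lemma bil_assoc:
  assumes "\<And>s t u. h1 (h2 s t) u = h3 s (h4 t u)"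
  shows "bil h1 (bil h2 f g) k = bil h3 f (bil h4 g k)"
  unfolding bil_def[of h1] bil_def[of h3] lin_ext_bil
  by (simp only: assms)

lemma free_pcomp_eq_bil: "free_pcomp i = bil (graft i)"
  by (intro ext) (simp add: free_pcomp_def bil_def lin_ext_def pm.scale_sum_right)

lemma linear_bil_left': "linear L \<Longrightarrow> linear (\<lambda>x. bil h (L x) g)"
  by (rule linear_compose[OF _ linear_bil_left])

lemma linear_bil_right': "linear L \<Longrightarrow> linear (\<lambda>x. bil h f (L x))"
  by (rule linear_compose[OF _ linear_bil_right])

lemma trilinear_eqI:
  assumes "\<And>g h. linear (\<lambda>f. L f g h)" "\<And>f h. linear (\<lambda>g. L f g h)" "\<And>f g. linear (\<lambda>h. L f g h)"
    and "\<And>g h. linear (\<lambda>f. M f g h)" "\<And>f h. linear (\<lambda>g. M f g h)" "\<And>f g. linear (\<lambda>h. M f g h)"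
    and "\<And>s t u. L (Poly_Mapping.single s 1) (Poly_Mapping.single t 1) (Poly_Mapping.single u 1)
      = M (Poly_Mapping.single s 1) (Poly_Mapping.single t 1) (Poly_Mapping.single u 1)"
  shows "L f g h = M f g h"
proof (rule linear_eqI[where L = "\<lambda>f. L f g h" and M = "\<lambda>f. M f g h"])
  fix s
  show "L (Poly_Mapping.single s 1) g h = M (Poly_Mapping.single s 1) g h"
  proof (rule linear_eqI[where L = "\<lambda>g. L _ g h" and M = "\<lambda>g. M _ g h"])
    fix t
    show "L (Poly_Mapping.single s 1) (Poly_Mapping.single t 1) h
        = M (Poly_Mapping.single s 1) (Poly_Mapping.single t 1) h"
      by (rule linear_eqI[where L = "\<lambda>h. L _ _ h" and M = "\<lambda>h. M _ _ h"]) (rule assms)+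
  qed (rule assms)+
qed (rule assms)+

lemma lin_ext_eq_0: "(\<And>x. x \<in> Poly_Mapping.keys f \<Longrightarrow> \<phi> x = 0) \<Longrightarrow> lin_ext \<phi> f = 0"
  by (simp add: lin_ext_def)

lemma keys_sum_in:
  "(\<And>i. i \<in> A \<Longrightarrow> Poly_Mapping.keys (g i) \<subseteq> K) \<Longrightarrow> Poly_Mapping.keys (sum g A) \<subseteq> K"
  using keys_sum_subset[of g A] by blast

lemma keys_lin_ext_in:
  "(\<And>x. x \<in> Poly_Mapping.keys f \<Longrightarrow> Poly_Mapping.keys (\<phi> x) \<subseteq> K) \<Longrightarrow> Poly_Mapping.keys (lin_ext \<phi> f) \<subseteq> K"
  using keys_lin_ext[of \<phi> f] by blast

lemma keys_diff_subset: "Poly_Mapping.keys (f - g) \<subseteq> Poly_Mapping.keys f \<union> Poly_Mapping.keys g"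
proof
  fix x assume "x \<in> Poly_Mapping.keys (f - g)"
  then have "Poly_Mapping.lookup f x \<noteq> 0 \<or> Poly_Mapping.lookup g x \<noteq> 0"
    unfolding in_keys_iff lookup_minus by force
  then show "x \<in> Poly_Mapping.keys f \<union> Poly_Mapping.keys g"
    by (simp add: in_keys_iff)
qed

lemma keys_diff_in:
  "Poly_Mapping.keys f \<subseteq> K \<Longrightarrow> Poly_Mapping.keys g \<subseteq> K \<Longrightarrow> Poly_Mapping.keys (f - g) \<subseteq> K"
  using keys_diff_subset[of f g] by blast

lemma linear_diff_fun: "linear L \<Longrightarrow> linear M \<Longrightarrow> linear (\<lambda>x. L x - M x)"
  by (rule pm.linear_compose_sub)

lemma linear_sum_fun: "(\<And>i. i \<in> A \<Longrightarrow> linear (L i)) \<Longrightarrow> linear (\<lambda>x. \<Sum>i\<in>A. L i x)"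
  by (rule linearI)
     (simp_all add: pm.linear_add pm.linear_scale sum.distrib pm.scale_sum_right)

section \<open>Spaces with a given basis\<close>

text \<open>Serves both for the components of the free operad and for the span of the normal trees.
  The dummy ring fields repeat those of \<open>free_component\<close>, so that
  \<open>free_component_eq\<close> is an equality of records.\<close>

definition supp_space :: "'a set \<Rightarrow> ('k::field, 'a \<Rightarrow>\<^sub>0 'k) module" where
  "supp_space K =
    \<lparr>carrier = {f. Poly_Mapping.keys f \<subseteq> K}, monoid.mult = (\<lambda>_ _. undefined), one = undefined,
     zero = 0, add = (+), smult = scale\<rparr>"

abbreviation trees :: "'g set \<Rightarrow> nat \<Rightarrow> 'g tree set" where
  "trees X n \<equiv> {t. size1 t = n \<and> set_tree t \<subseteq> X}"

lemma free_component_eq: "free_component X n = supp_space (trees X n)"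
  by (simp add: free_component_def supp_space_def)

lemma supp_space_simps [simp]:
  "carrier (supp_space K) = {f. Poly_Mapping.keys f \<subseteq> K}"
  "\<zero>\<^bsub>supp_space K\<^esub> = 0" "f \<oplus>\<^bsub>supp_space K\<^esub> g = f + g" "k \<odot>\<^bsub>supp_space K\<^esub> f = scale k f"
  by (simp_all add: supp_space_def)

lemma keys_add_subset:
  "Poly_Mapping.keys f \<subseteq> K \<Longrightarrow> Poly_Mapping.keys g \<subseteq> K \<Longrightarrow> Poly_Mapping.keys (f + g) \<subseteq> K"
  using Poly_Mapping.keys_add[of f g] by blast

lemma keys_scale_subset: "Poly_Mapping.keys f \<subseteq> K \<Longrightarrow> Poly_Mapping.keys (scale k f) \<subseteq> K"
  using keys_scale[of k f] by blast

lemma vectorspace_supp_space: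
  "vectorspace (class_ring :: 'k::field ring) (supp_space K :: ('k, 'a \<Rightarrow>\<^sub>0 'k) module)"
proof (rule vs_criteria)
  have "\<exists>g. Poly_Mapping.keys g \<subseteq> K \<and> f + g = 0" if "Poly_Mapping.keys f \<subseteq> K" for f :: "'a \<Rightarrow>\<^sub>0 'k"
    using that by (intro exI[of _ "- f"]) (auto simp: in_keys_iff)
  then show "\<forall>f\<in>carrier (supp_space K). \<exists>g\<in>carrier (supp_space K).
      f \<oplus>\<^bsub>supp_space K\<^esub> g = (\<zero>\<^bsub>supp_space K\<^esub> :: 'a \<Rightarrow>\<^sub>0 'k)"
    by simp
qed (auto simp: class_field algebra_simps keys_add_subset keys_scale_subset
    pm.scale_left_distrib pm.scale_right_distrib dest!: subsetD[OF keys_scale] subsetD[OF Poly_Mapping.keys_add])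

lemma dim_supp_space:
  assumes "finite K"
  shows "vectorspace.fin_dim class_ring (supp_space K :: ('k::field, 'a \<Rightarrow>\<^sub>0 'k) module)"
    and "vectorspace.dim class_ring (supp_space K :: ('k, 'a \<Rightarrow>\<^sub>0 'k) module) = card K"
proof -
  let ?V = "supp_space K :: ('k, 'a \<Rightarrow>\<^sub>0 'k) module"
  interpret V: vectorspace "class_ring :: 'k ring" ?V
    by (rule vectorspace_supp_space)
  let ?s = "\<lambda>x. Poly_Mapping.single x (1 :: 'k)"
  let ?B = "?s ` K"
  have B: "finite ?B" "?B \<subseteq> carrier ?V"
    using assms by auto
  have finsum: "finsum ?V h A = sum h A" if "finite A" "h \<in> A \<rightarrow> carrier ?V" for h and A :: "('a \<Rightarrow>\<^sub>0 'k) set"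
    using that by (induction A rule: finite_induct) auto
  have inj: "inj_on ?s K"
    by (rule inj_onI) (metis lookup_single_eq lookup_single_not_eq zero_neq_one)
  have lincomb: "V.lincomb a ?B = (\<Sum>x\<in>K. Poly_Mapping.single x (a (?s x)))" for a
  proof -
    have "V.lincomb a ?B = (\<Sum>v\<in>?B. scale (a v) v)"
      unfolding V.lincomb_def using B by (subst finsum) (auto dest!: subsetD[OF keys_scale])
    also have "\<dots> = (\<Sum>x\<in>K. Poly_Mapping.single x (a (?s x)))"
      by (subst sum.reindex[OF inj]) simp
    finally show ?thesis .
  qed
  have lookup_lincomb: "Poly_Mapping.lookup (V.lincomb a ?B) x = a (?s x)" if "x \<in> K" for a x
    using that assms by (simp add: lincomb lookup_sum lookup_single when_def sum.delta)
  have "V.lin_indpt ?B"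
  proof (rule V.finite_lin_indpt2[OF B])
    fix a assume "V.lincomb a ?B = \<zero>\<^bsub>?V\<^esub>"
    then show "\<forall>v\<in>?B. a v = \<zero>\<^bsub>class_ring\<^esub>"
      using lookup_lincomb[of _ a] by auto
  qed
  moreover have gen: "V.span ?B = carrier ?V"
  proof (rule subset_antisym)
    show "carrier ?V \<subseteq> V.span ?B"
    proof
      fix f assume f: "f \<in> carrier ?V"
      \<comment> \<open>Coefficients of a linear combination are indexed by vectors here, not by
        elements of \<open>K\<close>. Since \<open>?s\<close> is injective, the sum at
        \<open>?s y\<close> reduces to the term for \<open>y\<close>.\<close>
      let ?a = "\<lambda>v. \<Sum>x\<in>K. if ?s x = v then Poly_Mapping.lookup f x else 0"
      have a: "?a (?s y) = Poly_Mapping.lookup f y" if "y \<in> K" for y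
        using that assms inj by (subst sum.mono_neutral_right[of _ "{y}"]) (auto dest: inj_onD)
      have "V.lincomb ?a ?B = f"
      proof (rule poly_mapping_eqI)
        fix y
        show "Poly_Mapping.lookup (V.lincomb ?a ?B) y = Poly_Mapping.lookup f y"
        proof (cases "y \<in> K")
          case True
          then show ?thesis by (simp only: lookup_lincomb a)
        next
          case False
          with f have "Poly_Mapping.lookup f y = 0"
            by (auto simp: in_keys_iff)
          with False assms show ?thesis
            by (auto simp add: lincomb lookup_sum lookup_single when_def intro!: sum.neutral)
        qed
      qed
      then show "f \<in> V.span ?B"
        unfolding V.finite_span[OF B] by (intro CollectI exI[of _ ?a]) simp
    qed
  qed (rule V.span_is_subset2[OF B(2)])
  ultimately have "V.basis ?B"
    using B by (simp add: V.basis_def)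
  then show "V.dim = card K"
    using V.dim_basis[OF B(1)] card_image[OF inj] by simp
  show "V.fin_dim"
    unfolding V.fin_dim_def using B gen by blast
qed

section \<open>Quotients by kernels\<close>

text \<open>First isomorphism theorem: the cosets of the kernel are the fibres of \<open>T\<close>,
  and \<open>F\<close>, which sends a point of \<open>N\<close> to its fibre, is a linear bijection
  onto the quotient.\<close>

lemma dim_quotient_space_kernel:
  fixes V :: "('k::field, 'a) module" and N :: "('k, 'b) module"
  assumes "linear_map class_ring V N T" and surj: "T ` carrier V = carrier N"
    and fin: "vectorspace.fin_dim class_ring N"
    and W: "W = {x \<in> carrier V. T x = \<zero>\<^bsub>N\<^esub>}"
  shows "vectorspace.dim class_ring (quotient_space V W) = vectorspace.dim class_ring N"
proof -
  interpret V: vectorspace class_ring V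
    using assms(1) by (simp add: linear_map_def)
  interpret N: vectorspace class_ring N
    using assms(1) by (simp add: linear_map_def)
  interpret T: linear_map class_ring V N T by fact
  let ?Q = "quotient_space V W"
  define F where "F y = {x \<in> carrier V. T x = y}" for y
  have coset: "W +>\<^bsub>V\<^esub> x = F (T x)" if x: "x \<in> carrier V" for x
  proof (rule subset_antisym; rule subsetI)
    fix z assume "z \<in> W +>\<^bsub>V\<^esub> x"
    then show "z \<in> F (T x)"
      using x by (auto simp: a_r_coset_def' W F_def)
  next
    fix z assume z: "z \<in> F (T x)"
    then have "z \<ominus>\<^bsub>V\<^esub> x \<in> W"
      using x by (auto simp: W F_def a_minus_def N.module.M.r_neg)
    moreover have "z = (z \<ominus>\<^bsub>V\<^esub> x) \<oplus>\<^bsub>V\<^esub> x"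
      using z x by (simp add: F_def a_minus_def V.module.M.a_assoc V.module.M.l_neg)
    ultimately show "z \<in> W +>\<^bsub>V\<^esub> x"
      by (auto simp: a_r_coset_def')
  qed
  have car: "carrier ?Q = F ` carrier N"
    by (auto simp: quotient_space_def A_RCOSETS_def' coset simp flip: surj)
  have zero: "\<zero>\<^bsub>?Q\<^esub> = F \<zero>\<^bsub>N\<^esub>"
    by (simp add: quotient_space_def W F_def)
  have set_add: "F y <+>\<^bsub>V\<^esub> F z = F (y \<oplus>\<^bsub>N\<^esub> z)" if yz: "y \<in> carrier N" "z \<in> carrier N" for y z
  proof (rule subset_antisym; rule subsetI)
    fix x assume "x \<in> F y <+>\<^bsub>V\<^esub> F z"
    then show "x \<in> F (y \<oplus>\<^bsub>N\<^esub> z)"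
      by (auto simp: set_add_def' F_def)
  next
    fix x assume x: "x \<in> F (y \<oplus>\<^bsub>N\<^esub> z)"
    from yz(1) surj obtain u where u: "u \<in> carrier V" "T u = y" by (metis imageE)
    have "(y \<oplus>\<^bsub>N\<^esub> z) \<ominus>\<^bsub>N\<^esub> y = z"
      using yz by (simp add: N.module.M.a_comm[of y z] a_minus_def N.module.M.a_assoc N.module.M.r_neg)
    then have "x \<ominus>\<^bsub>V\<^esub> u \<in> F z"
      using x u by (simp add: F_def)
    moreover have "x = u \<oplus>\<^bsub>V\<^esub> (x \<ominus>\<^bsub>V\<^esub> u)"
      using x u by (simp add: F_def a_minus_def V.module.M.a_comm[of x] V.module.M.r_neg2)
    ultimately show "x \<in> F y <+>\<^bsub>V\<^esub> F z"
      using u by (auto simp: set_add_def' F_def)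
  qed
  have smult: "k \<odot>\<^bsub>?Q\<^esub> F y = F (k \<odot>\<^bsub>N\<^esub> y)" if y: "y \<in> carrier N" for k y
  proof -
    from y surj obtain u where u: "u \<in> carrier V" "T u = y" by (metis imageE)
    have W': "W = F \<zero>\<^bsub>N\<^esub>" by (simp add: W F_def)
    \<comment> \<open>For \<open>k = 0\<close> the image is just the zero vector, so in general only
      an inclusion holds before \<open>W\<close> is added.\<close>
    have sub: "(\<lambda>x. k \<odot>\<^bsub>V\<^esub> x) ` F y \<subseteq> F (k \<odot>\<^bsub>N\<^esub> y)"
      by (auto simp: F_def)
    have "W <+>\<^bsub>V\<^esub> (\<lambda>x. k \<odot>\<^bsub>V\<^esub> x) ` F y = F (k \<odot>\<^bsub>N\<^esub> y)"
    proof (rule subset_antisym)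
      have "W <+>\<^bsub>V\<^esub> (\<lambda>x. k \<odot>\<^bsub>V\<^esub> x) ` F y \<subseteq> W <+>\<^bsub>V\<^esub> F (k \<odot>\<^bsub>N\<^esub> y)"
        using sub by (auto simp: set_add_def')
      also have "\<dots> = F (k \<odot>\<^bsub>N\<^esub> y)"
        using y by (simp add: W' set_add)
      finally show "W <+>\<^bsub>V\<^esub> (\<lambda>x. k \<odot>\<^bsub>V\<^esub> x) ` F y \<subseteq> F (k \<odot>\<^bsub>N\<^esub> y)" .
      have "k \<odot>\<^bsub>V\<^esub> u \<in> (\<lambda>x. k \<odot>\<^bsub>V\<^esub> x) ` F y"
        using u by (auto simp: F_def)
      then have "W +>\<^bsub>V\<^esub> (k \<odot>\<^bsub>V\<^esub> u) \<subseteq> W <+>\<^bsub>V\<^esub> (\<lambda>x. k \<odot>\<^bsub>V\<^esub> x) ` F y"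
        unfolding set_add_def' a_r_coset_def' by blast
      then show "F (k \<odot>\<^bsub>N\<^esub> y) \<subseteq> W <+>\<^bsub>V\<^esub> (\<lambda>x. k \<odot>\<^bsub>V\<^esub> x) ` F y"
        using u by (simp add: coset)
    qed
    then show ?thesis by (simp add: quotient_space_def)
  qed
  have add: "F y \<oplus>\<^bsub>?Q\<^esub> F z = F (y \<oplus>\<^bsub>N\<^esub> z)" if "y \<in> carrier N" "z \<in> carrier N" for y z
    using set_add[OF that] by (simp add: quotient_space_def)
  \<comment> \<open>The vector space axioms are transported from \<open>N\<close> along
    \<open>F\<close>.\<close>
  have Q: "vectorspace class_ring ?Q"
  proof (rule vs_criteria)
    show "\<forall>v\<in>carrier ?Q. \<exists>w\<in>carrier ?Q. v \<oplus>\<^bsub>?Q\<^esub> w = \<zero>\<^bsub>?Q\<^esub>"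
    proof
      fix v assume "v \<in> carrier ?Q"
      then obtain y where y: "y \<in> carrier N" "v = F y" by (auto simp: car)
      then show "\<exists>w\<in>carrier ?Q. v \<oplus>\<^bsub>?Q\<^esub> w = \<zero>\<^bsub>?Q\<^esub>"
        by (intro bexI[of _ "F (\<ominus>\<^bsub>N\<^esub> y)"]) (auto simp: car add zero N.module.M.r_neg)
    qed
    show "\<forall>a b v. a \<in> carrier class_ring \<and> b \<in> carrier class_ring \<and> v \<in> carrier ?Q \<longrightarrow>
        (a \<otimes>\<^bsub>class_ring\<^esub> b) \<odot>\<^bsub>?Q\<^esub> v = a \<odot>\<^bsub>?Q\<^esub> (b \<odot>\<^bsub>?Q\<^esub> v)"
      using N.module.smult_assoc1 by (auto simp: car smult)
    show "\<forall>a b v. a \<in> carrier class_ring \<and> b \<in> carrier class_ring \<and> v \<in> carrier ?Q \<longrightarrow>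
        (a \<oplus>\<^bsub>class_ring\<^esub> b) \<odot>\<^bsub>?Q\<^esub> v = a \<odot>\<^bsub>?Q\<^esub> v \<oplus>\<^bsub>?Q\<^esub> b \<odot>\<^bsub>?Q\<^esub> v"
      using N.module.smult_l_distr by (auto simp: car smult add)
    show "\<forall>v\<in>carrier ?Q. \<one>\<^bsub>class_ring\<^esub> \<odot>\<^bsub>?Q\<^esub> v = v"
      using N.module.smult_one by (auto simp: car smult)
  qed (auto simp: class_field car add smult zero N.module.M.a_ac N.module.smult_r_distr)
  have "linear_map class_ring N ?Q F"
    using N.vectorspace_axioms Q
    by (auto simp: linear_map_def mod_hom_def mod_hom_axioms_def LinearCombinations.module_hom_def vectorspace_def
        car add smult)
  moreover have "inj_on F (carrier N)"
  proof (rule inj_onI)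
    fix y z assume y: "y \<in> carrier N" and eq: "F y = F z"
    from y surj obtain u where u: "u \<in> carrier V" "T u = y" by (metis imageE)
    then have "u \<in> F z"
      unfolding eq[symmetric] by (simp add: F_def)
    with u show "y = z" by (simp add: F_def)
  qed
  ultimately show ?thesis
    using linear_map.dim_eq[OF _ fin] car by metis
qed

section \<open>Two families of products on trees\<close>

definition tree_prod :: "'g \<Rightarrow> ('g tree \<Rightarrow>\<^sub>0 'k::field) \<Rightarrow> ('g tree \<Rightarrow>\<^sub>0 'k) \<Rightarrow> ('g tree \<Rightarrow>\<^sub>0 'k)" where
  "tree_prod a = bil (\<lambda>l r. \<langle>l, a, r\<rangle>)"

text \<open>The action of \<open>S b\<close> before any relation is imposed; its counterpart
  \<open>nsum_prod\<close> acts on normal forms.\<close>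

definition tree_sum_prod :: "nat \<Rightarrow> (nat tree \<Rightarrow>\<^sub>0 'k::field) \<Rightarrow> (nat tree \<Rightarrow>\<^sub>0 'k) \<Rightarrow> (nat tree \<Rightarrow>\<^sub>0 'k)" where
  "tree_sum_prod b f g = (\<Sum>a\<le>b. tree_prod a f g)"

definition nsum_prod :: "nat \<Rightarrow> (nat tree \<Rightarrow>\<^sub>0 'k::field) \<Rightarrow> (nat tree \<Rightarrow>\<^sub>0 'k) \<Rightarrow> (nat tree \<Rightarrow>\<^sub>0 'k)" where
  "nsum_prod b = bil (normal_mult b)"

text \<open>The dual generator recovered as \<open>S a - S (a - 1)\<close>. The case
  \<open>a = 0\<close> is separate because \<open>a - 1\<close> would truncate to 0 where an empty
  sum is meant.\<close>

definition nprod :: "nat \<Rightarrow> (nat tree \<Rightarrow>\<^sub>0 'k::field) \<Rightarrow> (nat tree \<Rightarrow>\<^sub>0 'k) \<Rightarrow> (nat tree \<Rightarrow>\<^sub>0 'k)" where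
  "nprod a f g = nsum_prod a f g - (if a = 0 then 0 else nsum_prod (a - 1) f g)"

lemma linear_tree_prod_left: "linear (\<lambda>f. tree_prod a f g)"
  and linear_tree_prod_right: "linear (\<lambda>g. tree_prod a f g)"
  unfolding tree_prod_def by (rule linear_bil_left linear_bil_right)+

lemma linear_tree_sum_prod_left: "linear (\<lambda>f. tree_sum_prod a f g)"
  and linear_tree_sum_prod_right: "linear (\<lambda>g. tree_sum_prod a f g)"
  unfolding tree_sum_prod_def
  by (intro linear_sum_fun linear_tree_prod_left linear_tree_prod_right)+

lemma linear_nsum_prod_left: "linear (\<lambda>f. nsum_prod a f g)"
  and linear_nsum_prod_right: "linear (\<lambda>g. nsum_prod a f g)"
  unfolding nsum_prod_def by (rule linear_bil_left linear_bil_right)+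

lemma linear_nprod_left: "linear (\<lambda>f. nprod a f g)"
  unfolding nprod_def by (cases "a = 0") (simp_all add: linear_diff_fun linear_nsum_prod_left)

lemma linear_nprod_right: "linear (\<lambda>g. nprod a f g)"
  unfolding nprod_def by (cases "a = 0") (simp_all add: linear_diff_fun linear_nsum_prod_right)

lemma sum_nprod: "(\<Sum>a\<le>b. nprod a f g) = nsum_prod b f g"
  by (induction b) (simp_all add: nprod_def)

lemma nsum_prod_assoc:
  "a \<le> b \<Longrightarrow> nsum_prod b (nsum_prod a f g) h = nsum_prod a f (nsum_prod b g h)"
  unfolding nsum_prod_def by (rule bil_assoc) (simp only: normal_mult_assoc)

text \<open>Difference of the associativity laws for \<open>a\<close> and \<open>a - 1\<close>, both
  at most \<open>b\<close>.\<close>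

lemma nsum_prod_nprod:
  "a \<le> b \<Longrightarrow> nsum_prod b (nprod a f g) h = nprod a f (nsum_prod b g h)"
  by (simp add: nprod_def pm.linear_diff[OF linear_nsum_prod_left]
      pm.linear_0[OF linear_nsum_prod_left] nsum_prod_assoc)

text \<open>A second difference, now in \<open>b\<close>: it takes \<open>a <= b - 1\<close>, hence
  the strict inequality. This law and \<open>nsum_prod_nprod\<close> account for all relations in
  the annihilator.\<close>

lemma nprod_nprod:
  assumes "a < b"
  shows "nprod b (nprod a f g) h = nprod a f (nprod b g h)"
proof -
  from assms have "a \<le> b" "a \<le> b - 1" "b \<noteq> 0" by auto
  then show ?thesis
    by (subst (1 4) nprod_def)
       (simp add: nsum_prod_nprod pm.linear_diff[OF linear_nprod_right])
qed

section \<open>Evaluation of trees\<close>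

text \<open>The products \<open>nprod\<close> make the vector space on all trees an algebra over the Koszul dual:
  \<open>nprod a\<close> is the action of the dual generator \<open>a\<close>.\<close>

fun eval_tree :: "nat tree \<Rightarrow> (nat \<Rightarrow> (nat tree \<Rightarrow>\<^sub>0 'k::field)) \<Rightarrow> (nat tree \<Rightarrow>\<^sub>0 'k)" where
  "eval_tree \<langle>\<rangle> e = e 0"
| "eval_tree \<langle>l, a, r\<rangle> e = nprod a (eval_tree l e) (eval_tree r (\<lambda>i. e (i + size1 l)))"

lemma eval_tree_cong: "(\<And>i. i < size1 t \<Longrightarrow> e i = e' i) \<Longrightarrow> eval_tree t e = eval_tree t e'"
proof (induction t arbitrary: e e')
  case (Node l a r)
  have "eval_tree l e = eval_tree l e'"
    by (rule Node.IH(1)) (use Node.prems in auto)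
  moreover have "eval_tree r (\<lambda>i. e (i + size1 l)) = eval_tree r (\<lambda>i. e' (i + size1 l))"
    by (rule Node.IH(2)) (use Node.prems in auto)
  ultimately show ?case by simp
qed simp

text \<open>Each input is used at exactly one leaf, and \<open>nprod\<close> is bilinear.\<close>

lemma linear_eval_tree: "i < size1 t \<Longrightarrow> linear (\<lambda>x. eval_tree t (e(i := x)))"
proof (induction t arbitrary: i e)
  case Leaf
  then show ?case by (simp add: linearI)
next
  case (Node l a r)
  show ?case
  proof (cases "i < size1 l")
    case True
    then have "(\<lambda>j. (e(i := x)) (j + size1 l)) = (\<lambda>j. e (j + size1 l))" for x
      by auto
    then show ?thesis
      using linear_compose[OF Node.IH(1)[OF True] linear_nprod_left] by (simp del: fun_upd_apply)
  next
    case False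
    then have *: "(\<lambda>j. (e(i := x)) (j + size1 l)) = (\<lambda>j. e (j + size1 l))(i - size1 l := x)" for x
      by (auto simp: fun_eq_iff)
    from False have "eval_tree l (e(i := x)) = eval_tree l e" for x
      by (intro eval_tree_cong) auto
    moreover have "i - size1 l < size1 r"
      using False Node.prems by simp
    ultimately show ?thesis
      using linear_compose[OF Node.IH(2) linear_nprod_right] by (simp add: * del: fun_upd_apply)
  qed
qed

text \<open>The input \<open>i\<close> of \<open>graft\<close> counts from 1, the environment from 0.\<close>

definition graft_env :: "nat \<Rightarrow> nat \<Rightarrow> (nat \<Rightarrow> 'b) \<Rightarrow> 'b \<Rightarrow> nat \<Rightarrow> 'b" where
  "graft_env i m e x j = (if Suc j < i then e j else if Suc j = i then x else e (j + m - 1))"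

text \<open>Position \<open>i - 1\<close> is the grafted input counted from 0; it is overwritten, so
  \<open>y\<close> is arbitrary. In this form \<open>linear_eval_tree\<close> applies to the
  dependence on \<open>x\<close>.\<close>

lemma graft_env_upd: "1 \<le> i \<Longrightarrow> graft_env i m e x = (graft_env i m e y)(i - 1 := x)"
  by (auto simp: graft_env_def fun_eq_iff)

lemma size1_graft:
  "1 \<le> i \<Longrightarrow> i \<le> size1 s \<Longrightarrow> size1 (graft i s t) = size1 s + size1 t - 1"
proof (induction i s t rule: graft.induct)
  case (2 i l a r s)
  then show ?case
    using size1_ge0[of l] size1_ge0[of s] by (cases "i \<le> size1 l") auto
qed simp

lemma set_tree_graft: "set_tree (graft i s t) \<subseteq> set_tree s \<union> set_tree t"
  by (induction i s t rule: graft.induct) auto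

text \<open>Grafting becomes substitution, so evaluation respects partial composition. The inputs of
  \<open>t\<close> start at position \<open>i - 1\<close> of \<open>e\<close>, and the later inputs
  of \<open>s\<close> move by \<open>size1 t - 1\<close>.\<close>

lemma eval_tree_graft:
  "1 \<le> i \<Longrightarrow> i \<le> size1 s \<Longrightarrow>
    eval_tree (graft i s t) e
      = eval_tree s (graft_env i (size1 t) e (eval_tree t (\<lambda>k. e (k + (i - 1)))))"
proof (induction s arbitrary: i e)
  case Leaf
  then show ?case by (simp add: graft_env_def)
next
  case (Node l a r)
  let ?x = "eval_tree t (\<lambda>k. e (k + (i - 1)))"
  show ?case
  proof (cases "i \<le> size1 l")
    case True
    \<comment> \<open>The offset of the right subtree changes with the grafting; the form with
      \<open>Suc\<close> avoids truncated subtraction.\<close>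
    have "Suc (size1 (graft i l t)) = size1 l + size1 t"
      using True Node.prems size1_ge0[of t] by (subst size1_graft) (auto simp del: size1_ge0)
    then have "eval_tree r (\<lambda>j. e (j + size1 (graft i l t)))
        = eval_tree r (\<lambda>j. graft_env i (size1 t) e ?x (j + size1 l))"
      using True by (intro eval_tree_cong) (auto simp: graft_env_def intro!: arg_cong[of _ _ e])
    then show ?thesis using True Node by simp
  next
    case False
    have "eval_tree l e = eval_tree l (graft_env i (size1 t) e ?x)"
      using False by (intro eval_tree_cong) (auto simp: graft_env_def)
    moreover have "eval_tree (graft (i - size1 l) r t) (\<lambda>j. e (j + size1 l))
        = eval_tree r (\<lambda>j. graft_env i (size1 t) e ?x (j + size1 l))"
    proof -
      have "(\<lambda>k. e (k + (i - size1 l - 1) + size1 l)) = (\<lambda>k. e (k + (i - 1)))"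
        using False by (intro ext arg_cong[of _ _ e]) auto
      moreover have "graft_env (i - size1 l) (size1 t) (\<lambda>j. e (j + size1 l)) x
          = (\<lambda>j. graft_env i (size1 t) e x (j + size1 l))" for x
        using False by (intro ext) (auto simp: graft_env_def intro!: arg_cong[of _ _ e])
      ultimately show ?thesis
        using False Node.prems by (subst Node.IH(2)) auto
    qed
    ultimately show ?thesis using False by simp
  qed
qed

section \<open>The ideal of elements acting by zero\<close>

abbreviation L3 :: "'g \<Rightarrow> 'g \<Rightarrow> 'g tree" where
  "L3 x y \<equiv> \<langle>\<langle>\<langle>\<rangle>, y, \<langle>\<rangle>\<rangle>, x, \<langle>\<rangle>\<rangle>"

abbreviation R3 :: "'g \<Rightarrow> 'g \<Rightarrow> 'g tree" where
  "R3 x y \<equiv> \<langle>\<langle>\<rangle>, x, \<langle>\<langle>\<rangle>, y, \<langle>\<rangle>\<rangle>\<rangle>"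

lemma free_operad_simps [simp]:
  "component (free_operad X) n = supp_space (trees X n)"
  "pcomp (free_operad X) n m i f g = bil (graft i) f g"
  by (simp_all add: free_operad_def free_component_eq free_pcomp_eq_bil)

lemma free_pcomp_gen:
  "free_pcomp 1 (gen x) (gen y) = Poly_Mapping.single (L3 x y) 1"
  "free_pcomp 2 (gen x) (gen y) = Poly_Mapping.single (R3 x y) 1"
  by (simp_all add: free_pcomp_eq_bil gen_def corolla_def)

text \<open>The kernel of evaluation into multilinear operations. All environments are quantified
  because composition changes the environment.\<close>

definition eval_ideal :: "nat set \<Rightarrow> nat \<Rightarrow> (nat tree \<Rightarrow>\<^sub>0 'k::field) set" where
  "eval_ideal X n = {f. Poly_Mapping.keys f \<subseteq> trees X n \<and> (\<forall>e. lin_ext (\<lambda>t. eval_tree t e) f = 0)}"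

lemma keys_graft:
  assumes "1 \<le> i" "i \<le> n" "Poly_Mapping.keys f \<subseteq> trees X n" "Poly_Mapping.keys g \<subseteq> trees X m"
  shows "Poly_Mapping.keys (bil (graft i) f g) \<subseteq> trees X (n + m - 1)"
proof
  fix u assume "u \<in> Poly_Mapping.keys (bil (graft i) f g)"
  then obtain s t where "u = graft i s t" "s \<in> Poly_Mapping.keys f" "t \<in> Poly_Mapping.keys g"
    using keys_bil by fast
  moreover from this assms have "size1 s = n" "set_tree s \<subseteq> X" "size1 t = m" "set_tree t \<subseteq> X"
    by auto
  ultimately show "u \<in> trees X (n + m - 1)"
    using size1_graft[of i s t] set_tree_graft[of i s t] assms(1,2) by simp blast
qed

text \<open>Grafting \<open>t\<close> into the trees of \<open>f\<close> only changes the
  environment in which \<open>f\<close> is evaluated; conversely, the value of \<open>g\<close>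
  enters an outer tree linearly.\<close>

lemma operad_ideal_eval_ideal: "operad_ideal (free_operad X) (eval_ideal X :: nat \<Rightarrow> (nat tree \<Rightarrow>\<^sub>0 'k::field) set)"
  unfolding operad_ideal_def
proof (intro conjI allI impI)
  fix n
  show "VectorSpace.subspace class_ring (eval_ideal X n :: (nat tree \<Rightarrow>\<^sub>0 'k) set) (component (free_operad X) n)"
    using vectorspace_supp_space[of "trees X n", where 'k = 'k]
    by (auto simp: VectorSpace.subspace_def submodule_def vectorspace_def eval_ideal_def
        lin_ext_add lin_ext_scale dest!: subsetD[OF keys_scale] subsetD[OF Poly_Mapping.keys_add])
next
  fix n m i and f g :: "nat tree \<Rightarrow>\<^sub>0 'k"
  assume i: "1 \<le> i" "i \<le> n" and f: "f \<in> eval_ideal X n" and g: "g \<in> carrier (component (free_operad X) m)"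
  have "lin_ext (\<lambda>t. eval_tree t e) (bil (graft i) f g) = 0" for e :: "nat \<Rightarrow> (nat tree \<Rightarrow>\<^sub>0 'k)"
    unfolding lin_ext_bil
  proof (subst lin_ext_swap, rule lin_ext_eq_0)
    fix t assume "t \<in> Poly_Mapping.keys g"
    \<comment> \<open>For fixed \<open>t\<close> the new environment is the same for every
      \<open>s\<close>, so \<open>f\<close> vanishes in it.\<close>
    have "lin_ext (\<lambda>s. eval_tree (graft i s t) e) f =
        lin_ext (\<lambda>s. eval_tree s (graft_env i (size1 t) e (eval_tree t (\<lambda>k. e (k + (i - 1)))))) f"
    proof (rule lin_ext_cong)
      fix s assume "s \<in> Poly_Mapping.keys f"
      with f have "size1 s = n" by (auto simp: eval_ideal_def)
      with i show "eval_tree (graft i s t) e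
          = eval_tree s (graft_env i (size1 t) e (eval_tree t (\<lambda>k. e (k + (i - 1)))))"
        by (intro eval_tree_graft) simp_all
    qed
    also have "\<dots> = 0"
      using f by (simp add: eval_ideal_def)
    finally show "lin_ext (\<lambda>s. eval_tree (graft i s t) e) f = 0" .
  qed
  with i f g show "pcomp (free_operad X) n m i f g \<in> eval_ideal X (n + m - 1)"
    using keys_graft[of i n f X g m] by (simp add: eval_ideal_def)
next
  fix n m i and f g :: "nat tree \<Rightarrow>\<^sub>0 'k"
  assume i: "1 \<le> i" "i \<le> n" and f: "f \<in> carrier (component (free_operad X) n)" and g: "g \<in> eval_ideal X m"
  have "lin_ext (\<lambda>t. eval_tree t e) (bil (graft i) f g) = 0" for e :: "nat \<Rightarrow> (nat tree \<Rightarrow>\<^sub>0 'k)"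
    unfolding lin_ext_bil
  proof (rule lin_ext_eq_0)
    fix s assume "s \<in> Poly_Mapping.keys f"
    with f have s: "size1 s = n" by auto
    \<comment> \<open>The placeholder 0 at the grafted input is overwritten by \<open>x\<close>. All
      trees of \<open>g\<close> have \<open>m\<close> leaves, so one map \<open>E\<close> serves
      them all.\<close>
    define E where "E x = eval_tree s ((graft_env i m e 0)(i - 1 := x))" for x
    have E: "linear E"
      unfolding E_def by (rule linear_eval_tree) (use s i in auto)
    have "lin_ext (\<lambda>t. eval_tree (graft i s t) e) g
        = lin_ext (\<lambda>t. E (eval_tree t (\<lambda>k. e (k + (i - 1))))) g"
    proof (rule lin_ext_cong)
      fix t assume "t \<in> Poly_Mapping.keys g"
      with g have "size1 t = m" by (auto simp: eval_ideal_def)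
      then show "eval_tree (graft i s t) e = E (eval_tree t (\<lambda>k. e (k + (i - 1))))"
        using i s by (simp add: E_def eval_tree_graft graft_env_upd[of i, symmetric] del: One_nat_def)
    qed
    also have "\<dots> = E (lin_ext (\<lambda>t. eval_tree t (\<lambda>k. e (k + (i - 1)))) g)"
      by (rule linear_lin_ext_commute[OF E, symmetric])
    also have "\<dots> = 0"
      using g pm.linear_0[OF E] by (simp add: eval_ideal_def)
    finally show "lin_ext (\<lambda>t. eval_tree (graft i s t) e) g = 0" .
  qed
  with i f g show "pcomp (free_operad X) n m i f g \<in> eval_ideal X (n + m - 1)"
    using keys_graft[of i n f X g m] by (simp add: eval_ideal_def)
qed

section \<open>The annihilator of the relations\<close>

lemma trees_3: "trees X 3 = (\<lambda>(x, y). L3 x y) ` (X \<times> X) \<union> (\<lambda>(x, y). R3 x y) ` (X \<times> X)" (is "_ = ?R")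
proof (rule subset_antisym; rule subsetI)
  fix t assume "t \<in> trees X 3"
  then obtain l a r where t: "t = \<langle>l, a, r\<rangle>" "size1 l + size1 r = 3" "a \<in> X"
      "set_tree l \<subseteq> X" "set_tree r \<subseteq> X"
    by (cases t) auto
  have corolla: "\<exists>y\<in>X. s = \<langle>\<langle>\<rangle>, y, \<langle>\<rangle>\<rangle>" if "size1 s = 2" "set_tree s \<subseteq> X" for s
    using that by (cases s) (auto simp: size1_size)
  have leaf: "s = \<langle>\<rangle>" if "size1 s = 1" for s :: "'a tree"
    using that by (cases s) (auto simp: size1_size)
  have "size1 l = 1 \<and> size1 r = 2 \<or> size1 l = 2 \<and> size1 r = 1"
    using t(2) size1_ge0[of l] size1_ge0[of r] by linarith
  then show "t \<in> ?R"
  proof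
    assume "size1 l = 1 \<and> size1 r = 2"
    then obtain y where "l = \<langle>\<rangle>" "r = \<langle>\<langle>\<rangle>, y, \<langle>\<rangle>\<rangle>" "y \<in> X"
      using leaf corolla t by blast
    then show ?thesis using t by auto
  next
    assume "size1 l = 2 \<and> size1 r = 1"
    then obtain y where "r = \<langle>\<rangle>" "l = \<langle>\<langle>\<rangle>, y, \<langle>\<rangle>\<rangle>" "y \<in> X"
      using leaf corolla t by blast
    then show ?thesis using t by auto
  qed
qed auto

section \<open>The pairing in the basis of trees\<close>

lemma pairing_eq:
  "pairing f g = (\<Sum>t\<in>Poly_Mapping.keys g.
    Poly_Mapping.lookup f t * Poly_Mapping.lookup g t * tree_pairing t t)"
proof -
  have "pairing f g = (\<Sum>t\<in>Poly_Mapping.keys g. \<Sum>s\<in>Poly_Mapping.keys f.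
      if s = t then Poly_Mapping.lookup f t * Poly_Mapping.lookup g t * tree_pairing t t else 0)"
    unfolding pairing_def by (subst sum.swap, intro sum.cong refl) (simp add: tree_pairing_def)
  also have "\<dots> = (\<Sum>t\<in>Poly_Mapping.keys g.
      Poly_Mapping.lookup f t * Poly_Mapping.lookup g t * tree_pairing t t)"
    by (intro sum.cong refl) (simp add: sum.delta in_keys_iff)
  finally show ?thesis .
qed

lemma pairing_0: "pairing f 0 = 0"
  by (simp add: pairing_eq)

lemma pairing_superset:
  "finite K \<Longrightarrow> Poly_Mapping.keys g \<subseteq> K \<Longrightarrow>
    pairing f g = (\<Sum>t\<in>K. Poly_Mapping.lookup f t * Poly_Mapping.lookup g t * tree_pairing t t)"
  unfolding pairing_eq by (rule sum.mono_neutral_left) (auto simp: in_keys_iff)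

lemma pairing_add: "pairing f (g + h) = pairing f g + pairing f h"
  using Poly_Mapping.keys_add[of g h]
  by (simp add: pairing_superset[of "Poly_Mapping.keys g \<union> Poly_Mapping.keys h"] lookup_add
      algebra_simps sum.distrib)

lemma pairing_scale: "pairing f (scale k g) = k * pairing f g"
  using keys_scale[of k g]
  by (simp add: pairing_superset[of "Poly_Mapping.keys g"] sum_distrib_left mult_ac)

text \<open>The sign of the pairing on \<open>R3\<close> cancels the sign in the relation.\<close>

lemma pairing_LR:
  "pairing f (Poly_Mapping.single (L3 x y) 1 - Poly_Mapping.single (R3 x' y') 1)
    = Poly_Mapping.lookup f (L3 x y) + Poly_Mapping.lookup f (R3 x' y')"
proof -
  have "tree_pairing (L3 x y) (L3 x y) = (1 :: 'a)" "tree_pairing (R3 x' y') (R3 x' y') = (- 1 :: 'a)"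
    by (auto simp: tree_pairing_def corolla_def)
  moreover have "Poly_Mapping.keys (Poly_Mapping.single (L3 x y) (1 :: 'a) - Poly_Mapping.single (R3 x' y') 1)
      \<subseteq> {L3 x y, R3 x' y'}"
    by (auto simp: in_keys_iff lookup_minus lookup_single when_def split: if_splits)
  ultimately show ?thesis
    by (subst pairing_superset[of "{L3 x y, R3 x' y'}"]) (auto simp: lookup_minus lookup_single)
qed

text \<open>By linearity in the second argument it suffices to pair with the spanning relations,
  which turns the annihilator into equations between coefficients.\<close>

lemma annihilator_Hi_relations:
  "f \<in> annihilator {0..c} (Hi_relations c :: (nat tree \<Rightarrow>\<^sub>0 'k::field) set) \<longleftrightarrow>
    Poly_Mapping.keys f \<subseteq> trees {0..c} 3 \<and>
    (\<forall>a a' b. a \<le> b \<longrightarrow> a' \<le> b \<longrightarrow> b \<le> c \<longrightarrow>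
      Poly_Mapping.lookup f (L3 a b) + Poly_Mapping.lookup f (R3 b a') = 0) \<and>
    (\<forall>a b. a < b \<longrightarrow> b \<le> c \<longrightarrow>
      Poly_Mapping.lookup f (L3 b a) + Poly_Mapping.lookup f (R3 a b) = 0)"
proof -
  let ?V = "supp_space (trees {0..c} 3) :: ('k, nat tree \<Rightarrow>\<^sub>0 'k) module"
  let ?G = "{Poly_Mapping.single (L3 a b) 1 - Poly_Mapping.single (R3 b a') (1 :: 'k) | a a' b.
      a \<le> b \<and> a' \<le> b \<and> b \<le> c} \<union>
    {Poly_Mapping.single (L3 b a) 1 - Poly_Mapping.single (R3 a b) 1 | a b. a < b \<and> b \<le> c}"
  interpret V: vectorspace "class_ring :: 'k ring" ?V
    by (rule vectorspace_supp_space)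
  have Hi: "Hi_relations c = V.span ?G"
    unfolding Hi_relations_def free_pcomp_gen by simp
  have keys: "Poly_Mapping.keys (Poly_Mapping.single s 1 - Poly_Mapping.single t (1 :: 'k)) \<subseteq> {s, t}" for s t :: "nat tree"
    by (auto simp: in_keys_iff lookup_minus lookup_single when_def split: if_splits)
  have G: "?G \<subseteq> carrier ?V"
    by (auto dest!: subsetD[OF keys])
  have "(\<forall>g\<in>V.span ?G. pairing f g = 0) \<longleftrightarrow> (\<forall>g\<in>?G. pairing f g = 0)"
  proof
    assume "\<forall>g\<in>V.span ?G. pairing f g = 0"
    then show "\<forall>g\<in>?G. pairing f g = 0"
      using V.in_own_span[OF G] by blast
  next
    assume *: "\<forall>g\<in>?G. pairing f g = 0"
    have sub: "submodule class_ring {g \<in> carrier ?V. pairing f g = 0} ?V"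
      using V.module_axioms
      by (auto simp: submodule_def pairing_add pairing_scale pairing_0
          dest!: subsetD[OF keys_scale] subsetD[OF Poly_Mapping.keys_add])
    have "?G \<subseteq> {g \<in> carrier ?V. pairing f g = 0}"
      using * G by blast
    from V.span_is_subset[OF this sub] show "\<forall>g\<in>V.span ?G. pairing f g = 0"
      by blast
  qed
  also have "\<dots> \<longleftrightarrow> (\<forall>a a' b. a \<le> b \<longrightarrow> a' \<le> b \<longrightarrow> b \<le> c \<longrightarrow>
      Poly_Mapping.lookup f (L3 a b) + Poly_Mapping.lookup f (R3 b a') = 0) \<and>
    (\<forall>a b. a < b \<longrightarrow> b \<le> c \<longrightarrow>
      Poly_Mapping.lookup f (L3 b a) + Poly_Mapping.lookup f (R3 a b) = 0)"
    unfolding ball_Un pairing_LR[symmetric] by blast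
  finally show ?thesis
    unfolding annihilator_def Hi by simp
qed

text \<open>The terms of \<open>L3 x y\<close> and \<open>R3 y x\<close> are paired. For
  \<open>x > y\<close> they cancel by \<open>nprod_nprod\<close>; for \<open>x <= y\<close> they
  share a coefficient up to sign, and their sum over \<open>x\<close> vanishes by
  \<open>nsum_prod_nprod\<close>.\<close>

lemma annihilator_subset_eval_ideal:
  "annihilator {0..c} (Hi_relations c) \<subseteq> (eval_ideal {0..c} 3 :: (nat tree \<Rightarrow>\<^sub>0 'k::field) set)"
proof
  fix f :: "nat tree \<Rightarrow>\<^sub>0 'k"
  assume "f \<in> annihilator {0..c} (Hi_relations c)"
  note rels = iffD1[OF annihilator_Hi_relations this]
  have keys: "Poly_Mapping.keys f \<subseteq> trees {0..c} 3"
    using rels by (rule conjunct1)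
  have rel1: "Poly_Mapping.lookup f (L3 a b) + Poly_Mapping.lookup f (R3 b a') = 0"
    if "a \<le> b" "a' \<le> b" "b \<le> c" for a a' b
    using rels[THEN conjunct2, THEN conjunct1, rule_format, OF that] .
  have rel2: "Poly_Mapping.lookup f (L3 b a) + Poly_Mapping.lookup f (R3 a b) = 0"
    if "a < b" "b \<le> c" for a b
    using rels[THEN conjunct2, THEN conjunct2, rule_format, OF that] .
  have "lin_ext (\<lambda>t. eval_tree t e) f = 0" for e :: "nat \<Rightarrow> (nat tree \<Rightarrow>\<^sub>0 'k)"
  proof -
    define u v w where "u = e 0" and "v = e 1" and "w = e 2"
    define P where "P x y = scale (Poly_Mapping.lookup f (L3 x y)) (nprod x (nprod y u v) w)" for x y
    define Q where "Q x y = scale (Poly_Mapping.lookup f (R3 x y)) (nprod x u (nprod y v w))" for x y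
    let ?X = "{0..c} \<times> {0..c}"
    have eval: "eval_tree (L3 x y) e = nprod x (nprod y u v) w"
        "eval_tree (R3 x y) e = nprod x u (nprod y v w)" for x y
      by (simp_all add: u_def v_def w_def numeral_2_eq_2)
    have "lin_ext (\<lambda>t. eval_tree t e) f
        = (\<Sum>t\<in>(\<lambda>(x, y). L3 x y) ` ?X \<union> (\<lambda>(x, y). R3 x y) ` ?X. scale (Poly_Mapping.lookup f t) (eval_tree t e))"
      by (rule lin_ext_superset) (use keys trees_3[of "{0..c}"] in auto)
    also have "\<dots> = (\<Sum>t\<in>(\<lambda>(x, y). L3 x y) ` ?X. scale (Poly_Mapping.lookup f t) (eval_tree t e))
        + (\<Sum>t\<in>(\<lambda>(x, y). R3 x y) ` ?X. scale (Poly_Mapping.lookup f t) (eval_tree t e))"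
      by (rule sum.union_disjoint) auto
    also have "(\<Sum>t\<in>(\<lambda>(x, y). L3 x y) ` ?X. scale (Poly_Mapping.lookup f t) (eval_tree t e))
        = (\<Sum>(x, y)\<in>?X. P x y)"
      by (subst sum.reindex) (auto simp: inj_on_def P_def eval intro!: sum.cong simp del: eval_tree.simps)
    also have "(\<Sum>t\<in>(\<lambda>(x, y). R3 x y) ` ?X. scale (Poly_Mapping.lookup f t) (eval_tree t e))
        = (\<Sum>(x, y)\<in>?X. Q x y)"
      by (subst sum.reindex) (auto simp: inj_on_def Q_def eval intro!: sum.cong simp del: eval_tree.simps)
    also have "(\<Sum>(x, y)\<in>?X. P x y) = (\<Sum>y\<in>{0..c}. \<Sum>x\<in>{0..c}. P x y)"
      by (subst sum.swap) (rule sum.cartesian_product[symmetric])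
    also have "(\<Sum>(x, y)\<in>?X. Q x y) = (\<Sum>y\<in>{0..c}. \<Sum>x\<in>{0..c}. Q y x)"
      by (rule sum.cartesian_product[symmetric])
    also have "(\<Sum>y\<in>{0..c}. \<Sum>x\<in>{0..c}. P x y) + (\<Sum>y\<in>{0..c}. \<Sum>x\<in>{0..c}. Q y x)
        = (\<Sum>y\<in>{0..c}. \<Sum>x\<in>{0..c}. P x y + Q y x)"
      by (simp add: sum.distrib)
    also have "\<dots> = 0"
    proof (rule sum.neutral, rule ballI)
      fix y assume y: "y \<in> {0..c}"
      \<comment> \<open>The first family of equations links all \<open>L3 x y\<close> and
        \<open>R3 y x\<close> with \<open>x <= y\<close>, so the coefficient of
        \<open>L3 y y\<close> determines all of them.\<close>
      define k where "k = Poly_Mapping.lookup f (L3 y y)"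
      have R: "Poly_Mapping.lookup f (R3 y x) = - k" if "x \<le> y" for x
        using rel1[of y y x] that y by (simp add: k_def eq_neg_iff_add_eq_0 add.commute)
      have L: "Poly_Mapping.lookup f (L3 x y) = k" if "x \<le> y" for x
        using rel1[of x y y] R[of y] that y by simp
      have "(\<Sum>x\<in>{0..c}. P x y + Q y x) = (\<Sum>x\<in>{..y}. P x y + Q y x)"
      proof (rule sum.mono_neutral_right)
        show "\<forall>x\<in>{0..c} - {..y}. P x y + Q y x = 0"
        proof
          fix x assume "x \<in> {0..c} - {..y}"
          then have x: "y < x" "x \<le> c" by auto
          have "Poly_Mapping.lookup f (L3 x y) = - Poly_Mapping.lookup f (R3 y x)"
            using rel2[OF x] by (simp add: eq_neg_iff_add_eq_0)
          then show "P x y + Q y x = 0"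
            by (simp add: P_def Q_def nprod_nprod[OF x(1)] pm.scale_minus_left)
        qed
      qed (use y in auto)
      also have "\<dots> = (\<Sum>x\<le>y. scale k (nprod x (nprod y u v) w) - scale k (nprod y u (nprod x v w)))"
        by (intro sum.cong refl) (simp add: P_def Q_def L R pm.scale_minus_left)
      also have "\<dots> = scale k (\<Sum>x\<le>y. nprod x (nprod y u v) w)
          - scale k (nprod y u (\<Sum>x\<le>y. nprod x v w))"
        by (simp add: sum_subtractf pm.scale_sum_right pm.linear_sum[OF linear_nprod_right])
      also have "\<dots> = 0"
        by (simp add: sum_nprod nsum_prod_nprod)
      finally show "(\<Sum>x\<in>{0..c}. P x y + Q y x) = 0" .
    qed
    finally show ?thesis .
  qed
  with keys show "f \<in> eval_ideal {0..c} 3"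
    by (simp add: eval_ideal_def)
qed

section \<open>Rewriting trees to normal trees\<close>

lemma keys_tree_prod:
  assumes "a \<in> X" "Poly_Mapping.keys f \<subseteq> trees X n" "Poly_Mapping.keys g \<subseteq> trees X m"
  shows "Poly_Mapping.keys (tree_prod a f g) \<subseteq> trees X (n + m)"
proof
  fix u assume "u \<in> Poly_Mapping.keys (tree_prod a f g)"
  then obtain s t where "u = \<langle>s, a, t\<rangle>" "s \<in> Poly_Mapping.keys f" "t \<in> Poly_Mapping.keys g"
    unfolding tree_prod_def using keys_bil by fast
  with assms show "u \<in> trees X (n + m)"
    by auto
qed

lemma keys_tree_sum_prod:
  assumes "b \<le> c" "Poly_Mapping.keys f \<subseteq> trees {0..c} n" "Poly_Mapping.keys g \<subseteq> trees {0..c} m"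
  shows "Poly_Mapping.keys (tree_sum_prod b f g) \<subseteq> trees {0..c} (n + m)"
  unfolding tree_sum_prod_def using assms by (intro keys_sum_in keys_tree_prod) auto

text \<open>\<open>sum_tree t\<close> is \<open>t\<close> read in the basis of the sums \<open>S b\<close> of dual generators.\<close>

fun sum_tree :: "nat tree \<Rightarrow> (nat tree \<Rightarrow>\<^sub>0 'k::field)" where
  "sum_tree \<langle>\<rangle> = Poly_Mapping.single \<langle>\<rangle> 1"
| "sum_tree \<langle>l, a, r\<rangle> = tree_sum_prod a (sum_tree l) (sum_tree r)"

lemma keys_sum_tree:
  "t \<in> trees {0..c} n \<Longrightarrow> Poly_Mapping.keys (sum_tree t :: nat tree \<Rightarrow>\<^sub>0 'k::field) \<subseteq> trees {0..c} n"
proof (induction t arbitrary: n)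
  case (Node l a r)
  have "Poly_Mapping.keys (tree_sum_prod a (sum_tree l) (sum_tree r :: nat tree \<Rightarrow>\<^sub>0 'k))
      \<subseteq> trees {0..c} (size1 l + size1 r)"
    by (rule keys_tree_sum_prod; (rule Node.IH)?) (use Node.prems in auto)
  with Node.prems show ?case by simp
qed simp

text \<open>Every input is set to the leaf, which keeps values in the span of normal trees. This one
  environment turns out to detect the whole ideal.\<close>

definition eval_free :: "(nat tree \<Rightarrow>\<^sub>0 'k::field) \<Rightarrow> (nat tree \<Rightarrow>\<^sub>0 'k)" where
  "eval_free = lin_ext (\<lambda>t. eval_tree t (\<lambda>_. Poly_Mapping.single \<langle>\<rangle> 1))"

lemma linear_eval_free: "linear eval_free"
  unfolding eval_free_def by (rule linear_lin_ext)

lemma keys_nsum_prod: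
  assumes "b \<le> c" "Poly_Mapping.keys f \<subseteq> normal_trees c 0 n" "Poly_Mapping.keys g \<subseteq> normal_trees c 0 m"
  shows "Poly_Mapping.keys (nsum_prod b f g) \<subseteq> normal_trees c 0 (n + m)"
proof
  fix u assume "u \<in> Poly_Mapping.keys (nsum_prod b f g)"
  then obtain s t where "u = normal_mult b s t" "s \<in> Poly_Mapping.keys f" "t \<in> Poly_Mapping.keys g"
    unfolding nsum_prod_def using keys_bil by fast
  with assms show "u \<in> normal_trees c 0 (n + m)"
    by (auto simp: normal_trees_def intro!: normal_tree_normal_mult)
qed

lemma keys_nprod:
  assumes "a \<le> c" "Poly_Mapping.keys f \<subseteq> normal_trees c 0 n" "Poly_Mapping.keys g \<subseteq> normal_trees c 0 m"
  shows "Poly_Mapping.keys (nprod a f g) \<subseteq> normal_trees c 0 (n + m)"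
  using assms keys_nsum_prod[of a c f n g m] keys_nsum_prod[of "a - 1" c f n g m]
  by (cases "a = 0") (simp_all add: nprod_def keys_diff_in)

lemma keys_eval_tree:
  "t \<in> trees {0..c} n \<Longrightarrow>
    Poly_Mapping.keys (eval_tree t (\<lambda>_. Poly_Mapping.single \<langle>\<rangle> (1 :: 'k::field))) \<subseteq> normal_trees c 0 n"
proof (induction t arbitrary: n)
  case Leaf
  then show ?case by (auto simp: normal_trees_def)
next
  case (Node l a r)
  have "Poly_Mapping.keys (eval_tree \<langle>l, a, r\<rangle> (\<lambda>_. Poly_Mapping.single \<langle>\<rangle> (1 :: 'k)))
      \<subseteq> normal_trees c 0 (size1 l + size1 r)"
    unfolding eval_tree.simps by (rule keys_nprod; (rule Node.IH)?) (use Node.prems in auto)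
  with Node.prems show ?case by simp
qed

text \<open>A constant environment is unchanged by the shift for the right subtree.\<close>

lemma eval_free_tree_prod: "eval_free (tree_prod a f g) = nprod a (eval_free f) (eval_free g)"
proof -
  have "eval_free (tree_prod a f g) = lin_ext (\<lambda>s. lin_ext (\<lambda>t.
      nprod a (eval_tree s (\<lambda>_. Poly_Mapping.single \<langle>\<rangle> 1)) (eval_tree t (\<lambda>_. Poly_Mapping.single \<langle>\<rangle> 1))) g) f"
    unfolding eval_free_def tree_prod_def lin_ext_bil by simp
  also have "\<dots> = nprod a (eval_free f) (eval_free g)"
    unfolding eval_free_def
    by (subst linear_lin_ext_commute[OF linear_nprod_left], subst linear_lin_ext_commute[OF linear_nprod_right])
       (rule refl)
  finally show ?thesis .
qed

lemma eval_free_tree_sum_prod: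
  "eval_free (tree_sum_prod b f g) = nsum_prod b (eval_free f) (eval_free g)"
  by (simp add: tree_sum_prod_def eval_free_tree_prod sum_nprod
      pm.linear_sum[OF linear_eval_free])

text \<open>\<open>S a\<close> acts by \<open>normal_mult a\<close>, which does not rewrite at a
  node of a normal tree. Hence \<open>sum_tree\<close> provides a section of evaluation.\<close>

lemma eval_free_sum_tree:
  "normal_tree c k t \<Longrightarrow> eval_free (sum_tree t) = Poly_Mapping.single t (1 :: 'k::field)"
proof (induction t arbitrary: k)
  case Leaf
  then show ?case by (simp add: eval_free_def)
next
  case (Node l a r)
  from Node.prems have "eval_free (sum_tree l) = Poly_Mapping.single l (1 :: 'k)"
      "eval_free (sum_tree r) = Poly_Mapping.single r (1 :: 'k)"
    by (auto intro: Node.IH)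
  moreover have "normal_mult a l r = \<langle>l, a, r\<rangle>"
    using Node.prems by (auto intro: normal_mult_eq_Node)
  ultimately show ?case by (simp add: eval_free_tree_sum_prod nsum_prod_def)
qed

section \<open>Ideals containing the annihilator\<close>

text \<open>Ideals are closed under partial compositions, so the product is expressed by them.
  Filling input 2 first leaves input 1 in place.\<close>

lemma tree_prod_eq_graft:
  "tree_prod a f g = bil (graft 1) (bil (graft 2) (gen a) g) f"
proof -
  have "bil (graft 1) (bil (graft 2) (gen a) g) f
      = lin_ext (\<lambda>t. lin_ext (\<lambda>s. Poly_Mapping.single \<langle>s, a, t\<rangle> 1) f) g"
    unfolding bil_def[of "graft 1"] lin_ext_bil by (simp add: gen_def corolla_def)
  then show ?thesis
    unfolding tree_prod_def bil_def[of "\<lambda>l r. \<langle>l, a, r\<rangle>"] by (subst lin_ext_swap) simp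
qed

text \<open>Filling the inputs from right to left keeps the numbers of the remaining ones.\<close>

lemma graft_L3:
  "bil (graft 1) (bil (graft 2) (bil (graft 3) (Poly_Mapping.single (L3 y x) 1) h) g) f
    = tree_prod y (tree_prod x f g) h"
  unfolding tree_prod_def
  by (rule trilinear_eqI[where L = "\<lambda>f g h. bil _ (bil _ (bil _ _ h) g) f" and M = "\<lambda>f g h. bil _ (bil _ f g) h"])
     (rule linear_bil_right linear_bil_left'[OF linear_bil_right] linear_bil_left'[OF linear_bil_left]
       linear_bil_left'[OF linear_bil_left'[OF linear_bil_right]] | simp)+

lemma graft_R3:
  "bil (graft 1) (bil (graft 2) (bil (graft 3) (Poly_Mapping.single (R3 x y) 1) h) g) f
    = tree_prod x f (tree_prod y g h)"
  unfolding tree_prod_def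
  by (rule trilinear_eqI[where L = "\<lambda>f g h. bil _ (bil _ (bil _ _ h) g) f" and M = "\<lambda>f g h. bil _ f (bil _ g h)"])
     (rule linear_bil_right linear_bil_left linear_bil_left'[OF linear_bil_right]
       linear_bil_right'[OF linear_bil_right] linear_bil_right'[OF linear_bil_left]
       linear_bil_left'[OF linear_bil_left'[OF linear_bil_right]] | simp)+

text \<open>The relation between \<open>S b\<close> composed with \<open>S a\<close> at input 1 and
  \<open>S a\<close> composed with \<open>S b\<close> at input 2, expanded in trees.\<close>

definition assoc_rel :: "nat \<Rightarrow> nat \<Rightarrow> (nat tree \<Rightarrow>\<^sub>0 'k::field)" where
  "assoc_rel a b = (\<Sum>y\<le>b. \<Sum>x\<le>a. Poly_Mapping.single (L3 y x) 1 - Poly_Mapping.single (R3 x y) 1)"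

lemma graft_assoc_rel:
  "bil (graft 1) (bil (graft 2) (bil (graft 3) (assoc_rel a b) h) g) f
    = tree_sum_prod b (tree_sum_prod a f g) h - tree_sum_prod a f (tree_sum_prod b g h)"
proof -
  have lin: "linear (\<lambda>T. bil (graft 1) (bil (graft 2) (bil (graft 3) T h) g) f)"
    by (rule linear_bil_left'[OF linear_bil_left'[OF linear_bil_left]])
  have "bil (graft 1) (bil (graft 2) (bil (graft 3) (assoc_rel a b) h) g) f
      = (\<Sum>y\<le>b. \<Sum>x\<le>a. tree_prod y (tree_prod x f g) h - tree_prod x f (tree_prod y g h))"
    by (simp only: assoc_rel_def pm.linear_sum[OF lin] pm.linear_diff[OF lin] graft_L3 graft_R3)
  also have "\<dots> = (\<Sum>y\<le>b. \<Sum>x\<le>a. tree_prod y (tree_prod x f g) h)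
      - (\<Sum>x\<le>a. \<Sum>y\<le>b. tree_prod x f (tree_prod y g h))"
    by (simp only: sum_subtractf, subst (2) sum.swap) (rule refl)
  also have "(\<Sum>y\<le>b. \<Sum>x\<le>a. tree_prod y (tree_prod x f g) h) = tree_sum_prod b (tree_sum_prod a f g) h"
    by (simp only: tree_sum_prod_def pm.linear_sum[OF linear_tree_prod_left])
  also have "(\<Sum>x\<le>a. \<Sum>y\<le>b. tree_prod x f (tree_prod y g h)) = tree_sum_prod a f (tree_sum_prod b g h)"
    by (simp only: tree_sum_prod_def pm.linear_sum[OF linear_tree_prod_right])
  finally show ?thesis .
qed

lemma lookup_assoc_rel:
  "Poly_Mapping.lookup (assoc_rel a b :: _ \<Rightarrow>\<^sub>0 'k::field) (L3 p q) = (if p \<le> b \<and> q \<le> a then 1 else 0)"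
  "Poly_Mapping.lookup (assoc_rel a b :: _ \<Rightarrow>\<^sub>0 'k) (R3 p q) = (if q \<le> b \<and> p \<le> a then - 1 else 0)"
proof -
  have delta: "(\<Sum>y\<le>b. if y = p then (\<Sum>x\<le>a. if x = q then z else 0) else 0)
      = (if p \<le> b \<and> q \<le> a then z else 0)" for p q :: nat and z :: 'k
    by (auto simp: sum.delta cong: if_cong)
  have "Poly_Mapping.lookup (assoc_rel a b :: _ \<Rightarrow>\<^sub>0 'k) (L3 p q)
      = (\<Sum>y\<le>b. if y = p then (\<Sum>x\<le>a. if x = q then 1 else 0) else 0)"
    unfolding assoc_rel_def lookup_sum lookup_minus lookup_single
    by (intro sum.cong refl) (auto simp: when_def sum_negf intro!: sum.cong)
  then show "Poly_Mapping.lookup (assoc_rel a b :: _ \<Rightarrow>\<^sub>0 'k) (L3 p q) = (if p \<le> b \<and> q \<le> a then 1 else 0)"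
    by (simp only: delta)
  have "Poly_Mapping.lookup (assoc_rel a b :: _ \<Rightarrow>\<^sub>0 'k) (R3 p q)
      = (\<Sum>y\<le>b. if y = q then (\<Sum>x\<le>a. if x = p then - 1 else 0) else 0)"
    unfolding assoc_rel_def lookup_sum lookup_minus lookup_single
    by (intro sum.cong refl) (auto simp: when_def sum_negf intro!: sum.cong)
  then show "Poly_Mapping.lookup (assoc_rel a b :: _ \<Rightarrow>\<^sub>0 'k) (R3 p q) = (if q \<le> b \<and> p \<le> a then - 1 else 0)"
    by (simp only: delta)
qed

text \<open>\<open>L3 p q\<close> and \<open>R3 q p\<close> always have opposite coefficients, which
  settles the second family of equations. In the first, the larger label is either above
  \<open>a\<close>, and both coefficients are 0, or at most \<open>a <= b\<close>, and they are 1
  and -1.\<close>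

lemma assoc_rel_annihilator:
  assumes "a \<le> b" "b \<le> c"
  shows "assoc_rel a b \<in> annihilator {0..c} (Hi_relations c)"
  unfolding annihilator_Hi_relations
proof (intro conjI)
  show "Poly_Mapping.keys (assoc_rel a b) \<subseteq> trees {0..c} 3"
    unfolding assoc_rel_def using assms by (intro keys_sum_in keys_diff_in) auto
qed (use assms in \<open>auto simp: lookup_assoc_rel\<close>)

text \<open>\<open>I\<close> is an arbitrary ideal containing the annihilator; what holds for every
  such \<open>I\<close> passes to their intersection, the generated ideal.\<close>

context
  fixes c :: nat and I :: "nat \<Rightarrow> (nat tree \<Rightarrow>\<^sub>0 'k::field) set"
  assumes ideal: "operad_ideal (free_operad {0..c}) I"
    and ann: "annihilator {0..c} (Hi_relations c) \<subseteq> I 3"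
begin

lemma ideal_submodule: "submodule class_ring (I n) (supp_space (trees {0..c} n))"
  using ideal by (simp add: operad_ideal_def VectorSpace.subspace_def)

lemma ideal_0: "0 \<in> I n"
  and ideal_add: "f \<in> I n \<Longrightarrow> g \<in> I n \<Longrightarrow> f + g \<in> I n"
  and ideal_scale: "f \<in> I n \<Longrightarrow> scale k f \<in> I n"
  using submodule.zero_closed[OF ideal_submodule[of n]] submodule.m_closed[OF ideal_submodule[of n], of f g]
    submodule.smult_closed[OF ideal_submodule[of n], of k f]
  by simp_all

lemma ideal_diff: "f \<in> I n \<Longrightarrow> g \<in> I n \<Longrightarrow> f - g \<in> I n"
  using ideal_add[OF _ ideal_scale[of g n "- 1"], of f] by (simp add: pm.scale_minus_left)

lemma ideal_sum: "(\<And>i. i \<in> A \<Longrightarrow> h i \<in> I n) \<Longrightarrow> sum h A \<in> I n"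
  by (induction A rule: infinite_finite_induct) (auto simp: ideal_0 ideal_add)

lemma ideal_lin_ext: "(\<And>x. x \<in> Poly_Mapping.keys f \<Longrightarrow> \<phi> x \<in> I n) \<Longrightarrow> lin_ext \<phi> f \<in> I n"
  unfolding lin_ext_def by (intro ideal_sum ideal_scale)

lemma ideal_graft_left:
  "1 \<le> i \<Longrightarrow> i \<le> n \<Longrightarrow> f \<in> I n \<Longrightarrow> Poly_Mapping.keys g \<subseteq> trees {0..c} m \<Longrightarrow>
    bil (graft i) f g \<in> I (n + m - 1)"
  using ideal[unfolded operad_ideal_def, THEN conjunct2, THEN conjunct1, rule_format, of i n f g m]
  by simp

lemma ideal_graft_right:
  "1 \<le> i \<Longrightarrow> i \<le> n \<Longrightarrow> Poly_Mapping.keys f \<subseteq> trees {0..c} n \<Longrightarrow> g \<in> I m \<Longrightarrow>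
    bil (graft i) f g \<in> I (n + m - 1)"
  using ideal[unfolded operad_ideal_def, THEN conjunct2, THEN conjunct2, rule_format, of i n f g m]
  by simp

lemma keys_gen: "a \<le> c \<Longrightarrow> Poly_Mapping.keys (gen a :: nat tree \<Rightarrow>\<^sub>0 'k) \<subseteq> trees {0..c} 2"
  by (simp add: gen_def corolla_def)

lemma ideal_tree_prod_left:
  assumes "a \<le> c" "f \<in> I n" "Poly_Mapping.keys g \<subseteq> trees {0..c} m"
  shows "tree_prod a f g \<in> I (n + m)"
proof -
  have "Poly_Mapping.keys (bil (graft 2) (gen a) g) \<subseteq> trees {0..c} (2 + m - 1)"
    using assms by (intro keys_graft keys_gen) auto
  from ideal_graft_right[OF _ _ this assms(2), of 1] show ?thesis
    by (simp add: tree_prod_eq_graft add.commute)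
qed

lemma ideal_tree_prod_right:
  assumes "a \<le> c" "Poly_Mapping.keys f \<subseteq> trees {0..c} n" "g \<in> I m"
  shows "tree_prod a f g \<in> I (n + m)"
proof -
  have "bil (graft 2) (gen a) g \<in> I (2 + m - 1)"
    using assms by (intro ideal_graft_right keys_gen) auto
  from ideal_graft_left[OF _ _ this assms(2), of 1] show ?thesis
    by (simp add: tree_prod_eq_graft add.commute)
qed

lemma ideal_tree_sum_prod_right:
  "b \<le> c \<Longrightarrow> Poly_Mapping.keys f \<subseteq> trees {0..c} n \<Longrightarrow> g \<in> I m \<Longrightarrow> tree_sum_prod b f g \<in> I (n + m)"
  unfolding tree_sum_prod_def by (intro ideal_sum ideal_tree_prod_right) auto

text \<open>The element \<open>assoc_rel a b\<close> of \<open>I\<close>, with \<open>h\<close>,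
  \<open>g\<close> and \<open>f\<close> grafted into its three inputs.\<close>

lemma tree_sum_prod_assoc:
  assumes "a \<le> b" "b \<le> c" and f: "Poly_Mapping.keys f \<subseteq> trees {0..c} n"
    and g: "Poly_Mapping.keys g \<subseteq> trees {0..c} m" and h: "Poly_Mapping.keys h \<subseteq> trees {0..c} p"
  shows "tree_sum_prod b (tree_sum_prod a f g) h - tree_sum_prod a f (tree_sum_prod b g h) \<in> I (n + (m + p))"
proof -
  have "assoc_rel a b \<in> I 3"
    using ann assoc_rel_annihilator[OF assms(1,2)] by blast
  from ideal_graft_left[OF _ _ this h, of 3]
  have "bil (graft 3) (assoc_rel a b) h \<in> I (3 + p - 1)"
    by simp
  from ideal_graft_left[OF _ _ this g, of 2]
  have "bil (graft 2) (bil (graft 3) (assoc_rel a b) h) g \<in> I (3 + p - 1 + m - 1)"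
    by simp
  from ideal_graft_left[OF _ _ this f, of 1]
  have "bil (graft 1) (bil (graft 2) (bil (graft 3) (assoc_rel a b) h) g) f \<in> I (3 + p - 1 + m - 1 + n - 1)"
    by simp
  moreover have "3 + p - 1 + m - 1 + n - 1 = n + (m + p)"
    by simp
  ultimately show ?thesis
    by (simp only: graft_assoc_rel)
qed

text \<open>The induction follows the recursion of \<open>normal_mult\<close>: if
  \<open>a <= b\<close>, one rewriting modulo \<open>I\<close> moves the product into the right
  subtree; otherwise the difference is 0.\<close>

lemma sum_tree_normal_mult:
  assumes "b \<le> c" "t \<in> trees {0..c} m" "s \<in> trees {0..c} n"
  shows "tree_sum_prod b (sum_tree s) (sum_tree t) - sum_tree (normal_mult b s t) \<in> I (n + m)"
  using assms(3)
proof (induction s arbitrary: n)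
  case Leaf
  then show ?case by (simp add: ideal_0)
next
  case (Node l a r)
  show ?case
  proof (cases "a \<le> b")
    case True
    from Node.prems have l: "l \<in> trees {0..c} (size1 l)" and r: "r \<in> trees {0..c} (size1 r)"
      and n: "n = size1 l + size1 r" and "a \<le> c"
      by auto
    let ?l = "sum_tree l :: nat tree \<Rightarrow>\<^sub>0 'k" and ?r = "sum_tree r :: nat tree \<Rightarrow>\<^sub>0 'k"
      and ?t = "sum_tree t :: nat tree \<Rightarrow>\<^sub>0 'k"
    have "tree_sum_prod b (tree_sum_prod a ?l ?r) ?t - tree_sum_prod a ?l (tree_sum_prod b ?r ?t) \<in> I (n + m)"
      using tree_sum_prod_assoc[OF True assms(1) keys_sum_tree[OF l] keys_sum_tree[OF r] keys_sum_tree[OF assms(2)]]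
      by (simp add: n add.assoc)
    moreover have "tree_sum_prod a ?l (tree_sum_prod b ?r ?t - sum_tree (normal_mult b r t)) \<in> I (n + m)"
      using ideal_tree_sum_prod_right[OF \<open>a \<le> c\<close> keys_sum_tree[OF l] Node.IH(2)[OF r]]
      by (simp add: n add.assoc)
    ultimately have "(tree_sum_prod b (tree_sum_prod a ?l ?r) ?t - tree_sum_prod a ?l (tree_sum_prod b ?r ?t))
        + tree_sum_prod a ?l (tree_sum_prod b ?r ?t - sum_tree (normal_mult b r t)) \<in> I (n + m)"
      by (rule ideal_add)
    then show ?thesis
      using True by (simp add: pm.linear_diff[OF linear_tree_sum_prod_right])
  next
    case False
    then show ?thesis by (simp add: ideal_0)
  qed
qed

lemma tree_sum_prod_lin_ext:
  assumes "b \<le> c" "Poly_Mapping.keys f \<subseteq> trees {0..c} n" "Poly_Mapping.keys g \<subseteq> trees {0..c} m"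
  shows "tree_sum_prod b (lin_ext sum_tree f) (lin_ext sum_tree g) - lin_ext sum_tree (nsum_prod b f g) \<in> I (n + m)"
proof -
  have "tree_sum_prod b (lin_ext sum_tree f) (lin_ext sum_tree g)
      = lin_ext (\<lambda>s. lin_ext (\<lambda>t. tree_sum_prod b (sum_tree s) (sum_tree t)) g) f"
    by (subst linear_lin_ext_commute[OF linear_tree_sum_prod_left],
        subst linear_lin_ext_commute[OF linear_tree_sum_prod_right]) (rule refl)
  moreover have "lin_ext sum_tree (nsum_prod b f g)
      = lin_ext (\<lambda>s. lin_ext (\<lambda>t. sum_tree (normal_mult b s t)) g) f"
    unfolding nsum_prod_def by (rule lin_ext_bil)
  ultimately have "tree_sum_prod b (lin_ext sum_tree f) (lin_ext sum_tree g) - lin_ext sum_tree (nsum_prod b f g)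
      = lin_ext (\<lambda>s. lin_ext (\<lambda>t. tree_sum_prod b (sum_tree s) (sum_tree t)
          - sum_tree (normal_mult b s t)) g) f"
    by (simp add: lin_ext_def sum_subtractf pm.scale_right_diff_distrib)
  also have "\<dots> \<in> I (n + m)"
    using assms by (intro ideal_lin_ext sum_tree_normal_mult) auto
  finally show ?thesis .
qed

lemma tree_prod_lin_ext:
  assumes "a \<le> c" "Poly_Mapping.keys f \<subseteq> trees {0..c} n" "Poly_Mapping.keys g \<subseteq> trees {0..c} m"
  shows "tree_prod a (lin_ext sum_tree f) (lin_ext sum_tree g) - lin_ext sum_tree (nprod a f g) \<in> I (n + m)"
proof (cases a)
  case 0
  with tree_sum_prod_lin_ext[OF assms] show ?thesis
    by (simp add: tree_sum_prod_def nprod_def)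
next
  case (Suc b)
  let ?D = "\<lambda>b. tree_sum_prod b (lin_ext sum_tree f) (lin_ext sum_tree g) - lin_ext sum_tree (nsum_prod b f g)"
  \<comment> \<open>Both families of products express a single generator as
    \<open>S a - S (a - 1)\<close>.\<close>
  have "?D a - ?D b \<in> I (n + m)"
    using assms Suc by (intro ideal_diff tree_sum_prod_lin_ext) auto
  with Suc show ?thesis
    by (simp add: tree_sum_prod_def nprod_def lin_ext_diff algebra_simps)
qed

text \<open>Modulo \<open>I\<close> a tree equals its evaluation read back in the basis
  \<open>S\<close>; this is the rewriting to normal form.\<close>

lemma single_normal_form:
  "t \<in> trees {0..c} n \<Longrightarrow>
    Poly_Mapping.single t 1 - lin_ext sum_tree (eval_tree t (\<lambda>_. Poly_Mapping.single \<langle>\<rangle> 1)) \<in> I n"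
proof (induction t arbitrary: n)
  case Leaf
  then show ?case by (simp add: ideal_0)
next
  case (Node l a r)
  from Node.prems have l: "l \<in> trees {0..c} (size1 l)" and r: "r \<in> trees {0..c} (size1 r)"
    and n: "n = size1 l + size1 r" and "a \<le> c"
    by auto
  let ?e = "\<lambda>t. eval_tree t (\<lambda>_. Poly_Mapping.single \<langle>\<rangle> (1 :: 'k))"
  let ?S = "\<lambda>t. lin_ext sum_tree (?e t)"
  have sub: "normal_trees c 0 m \<subseteq> trees {0..c} m" for m
    using normal_tree_set_tree by (auto simp: normal_trees_def)
  have e: "Poly_Mapping.keys (?e t) \<subseteq> trees {0..c} m" if "t \<in> trees {0..c} m" for t m
    using keys_eval_tree[OF that, where 'k = 'k] sub by blast
  have S: "Poly_Mapping.keys (?S t) \<subseteq> trees {0..c} m" if "t \<in> trees {0..c} m" for t m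
    using e[OF that] by (intro keys_lin_ext_in keys_sum_tree) blast
  \<comment> \<open>Three differences that telescope: the left factor is replaced, then the right
    one, then the product is normalised.\<close>
  have "tree_prod a (Poly_Mapping.single l 1 - ?S l) (Poly_Mapping.single r 1) \<in> I n"
    unfolding n using r by (intro ideal_tree_prod_left \<open>a \<le> c\<close> Node.IH(1)[OF l]) simp
  moreover have "tree_prod a (?S l) (Poly_Mapping.single r 1 - ?S r) \<in> I n"
    unfolding n by (intro ideal_tree_prod_right \<open>a \<le> c\<close> S[OF l] Node.IH(2)[OF r])
  moreover have "tree_prod a (?S l) (?S r) - lin_ext sum_tree (nprod a (?e l) (?e r)) \<in> I n"
    unfolding n by (intro tree_prod_lin_ext \<open>a \<le> c\<close> e l r)
  ultimately have "tree_prod a (Poly_Mapping.single l 1 - ?S l) (Poly_Mapping.single r 1)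
      + tree_prod a (?S l) (Poly_Mapping.single r 1 - ?S r)
      + (tree_prod a (?S l) (?S r) - lin_ext sum_tree (nprod a (?e l) (?e r))) \<in> I n"
    by (intro ideal_add)
  moreover have "tree_prod a (Poly_Mapping.single l 1) (Poly_Mapping.single r 1)
      = Poly_Mapping.single \<langle>l, a, r\<rangle> (1 :: 'k)"
    by (simp add: tree_prod_def)
  ultimately show ?case
    by (simp add: pm.linear_diff[OF linear_tree_prod_left] pm.linear_diff[OF linear_tree_prod_right])
qed

lemma normal_form:
  assumes "Poly_Mapping.keys f \<subseteq> trees {0..c} n"
  shows "f - lin_ext sum_tree (eval_free f) \<in> I n"
proof -
  have "lin_ext sum_tree (eval_free f)
      = lin_ext (\<lambda>t. lin_ext sum_tree (eval_tree t (\<lambda>_. Poly_Mapping.single \<langle>\<rangle> 1))) f"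
    unfolding eval_free_def by (rule linear_lin_ext_commute[OF linear_lin_ext])
  then have "f - lin_ext sum_tree (eval_free f) = lin_ext (\<lambda>t. Poly_Mapping.single t 1
      - lin_ext sum_tree (eval_tree t (\<lambda>_. Poly_Mapping.single \<langle>\<rangle> 1))) f"
    by (subst lin_ext_singles[of f, symmetric])
       (simp add: lin_ext_def sum_subtractf pm.scale_right_diff_distrib del: scale_single)
  also have "\<dots> \<in> I n"
    using assms by (intro ideal_lin_ext single_normal_form) blast
  finally show ?thesis .
qed

end

text \<open>One inclusion holds since \<open>eval_ideal\<close> is among the intersected ideals; for
  the other, \<open>normal_form\<close> puts an element with zero evaluation into each of
  them.\<close>

lemma generated_ideal_annihilator:
  "generated_ideal (free_operad {0..c}) 3 (annihilator {0..c} (Hi_relations c)) n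
    = {f \<in> carrier (supp_space (trees {0..c} n)). eval_free f = (0 :: nat tree \<Rightarrow>\<^sub>0 'k::field)}"
  (is "?G = ?K")
proof (rule subset_antisym)
  have "?G \<subseteq> eval_ideal {0..c} n"
    unfolding generated_ideal_def
    using operad_ideal_eval_ideal[of "{0..c}", where 'k = 'k] annihilator_subset_eval_ideal by blast
  also have "\<dots> \<subseteq> ?K"
    by (auto simp: eval_ideal_def eval_free_def)
  finally show "?G \<subseteq> ?K" .
  show "?K \<subseteq> ?G"
  proof
    fix f :: "nat tree \<Rightarrow>\<^sub>0 'k" assume "f \<in> ?K"
    then have "f \<in> I n" if "operad_ideal (free_operad {0..c}) I"
        "annihilator {0..c} (Hi_relations c) \<subseteq> I 3" for I :: "nat \<Rightarrow> (nat tree \<Rightarrow>\<^sub>0 'k) set"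
      using normal_form[OF that, of f n] by simp
    then show "f \<in> ?G"
      unfolding generated_ideal_def by blast
  qed
qed

theorem proposition4p2p5:
  fixes c n :: nat
  assumes "n \<ge> 1"
  shows "of_nat (operad_dim
      (koszul_dual {0..c} (Hi_relations c :: (nat tree \<Rightarrow>\<^sub>0 'k::field_char_0) set)) n)
    = fuss_catalan c n"
proof -
  let ?V = "supp_space (trees {0..c} n) :: ('k, nat tree \<Rightarrow>\<^sub>0 'k) module"
  let ?N = "supp_space (normal_trees c 0 n) :: ('k, nat tree \<Rightarrow>\<^sub>0 'k) module"
  have eval: "Poly_Mapping.keys (eval_free f) \<subseteq> normal_trees c 0 n"
    if "Poly_Mapping.keys f \<subseteq> trees {0..c} n" for f :: "nat tree \<Rightarrow>\<^sub>0 'k"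
    unfolding eval_free_def using that by (intro keys_lin_ext_in keys_eval_tree) blast
  have "linear_map class_ring ?V ?N eval_free"
    using vectorspace_supp_space[of "trees {0..c} n", where 'k = 'k]
      vectorspace_supp_space[of "normal_trees c 0 n", where 'k = 'k] eval
    by (auto simp: linear_map_def mod_hom_def mod_hom_axioms_def LinearCombinations.module_hom_def
        vectorspace_def pm.linear_add[OF linear_eval_free] pm.linear_scale[OF linear_eval_free])
  moreover have "eval_free ` carrier ?V = carrier ?N"
  proof (rule subset_antisym)
    show "carrier ?N \<subseteq> eval_free ` carrier ?V"
    proof
      fix g assume "g \<in> carrier ?N"
      then have g: "Poly_Mapping.keys g \<subseteq> normal_trees c 0 n" by simp
      \<comment> \<open>The preimage is \<open>g\<close> read in the basis \<open>S\<close>.\<close>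
      let ?f = "lin_ext sum_tree g"
      have "Poly_Mapping.keys (sum_tree t :: nat tree \<Rightarrow>\<^sub>0 'k) \<subseteq> trees {0..c} n" if "t \<in> Poly_Mapping.keys g" for t
        using that g normal_tree_set_tree[of c 0 t] by (intro keys_sum_tree) (auto simp: normal_trees_def)
      then have "Poly_Mapping.keys ?f \<subseteq> trees {0..c} n"
        by (rule keys_lin_ext_in)
      moreover have "eval_free ?f = lin_ext (\<lambda>t. eval_free (sum_tree t)) g"
        by (rule linear_lin_ext_commute[OF linear_eval_free])
      moreover have "\<dots> = lin_ext (\<lambda>t. Poly_Mapping.single t 1) g"
        using g by (intro lin_ext_cong eval_free_sum_tree[of c 0]) (auto simp: normal_trees_def)
      ultimately show "g \<in> eval_free ` carrier ?V"
        by (intro image_eqI[of _ _ ?f]) (simp_all add: lin_ext_singles)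
    qed
  qed (use eval in auto)
  \<comment> \<open>Evaluation is onto the span of normal trees, and its kernel is the
    ideal.\<close>
  ultimately have "vectorspace.dim class_ring (quotient_space ?V
        {f \<in> carrier ?V. eval_free f = 0}) = vectorspace.dim class_ring ?N"
    by (rule dim_quotient_space_kernel) (simp_all add: dim_supp_space finite_normal_trees)
  then have "operad_dim (koszul_dual {0..c} (Hi_relations c :: (nat tree \<Rightarrow>\<^sub>0 'k) set)) n
      = card (normal_trees c 0 n)"
    unfolding operad_dim_def koszul_dual_def quadratic_operad_def quotient_operad_def
    by (simp add: generated_ideal_annihilator dim_supp_space finite_normal_trees)
  then show ?thesis
    by (simp add: card_normal_trees[OF assms])
qed

end
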